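(* Let $I=[0,1]$ or $I=[0,\infty)$, and let $1\le p<\infty$. Then: (a) $Ces_p(I)$ is not a dual space; (b) $Ces_p(I)$ does not have the Radon-Nikodym property.
   Context: For $1\le p<\infty$, the Cesàro function space $Ces_p(I)$ is the space of all (classes, modulo equality almost everywhere, of) Lebesgue measurable real functions $f$ on $I$ such that $$\|f\|_{C(p)}=\left[\int_I\left(\frac1x\int_0^x|f(t)|\,dt\right)^p dx\right]^{1/p}<\infty,$$ equipped with the norm $\|\cdot\|_{C(p)}$. Being a dual space is understood as an isomorphism-invariant property: a Banach space $X$ is a dual space if it is isomorphic (linearly homeomorphic) to the dual $Y^*$ of some Banach space $Y$. The Radon-Nikodym property is the usual one: a Banach space $X$ has it if, for every finite measure space $(\Omega,\Sigma,\mu)$, every $\mu$-continuous countably additive vector measure $G:\Sigma\to X$ of bounded variation has the form $G(E)=\int_E g\,d\mu$ for all $E\in\Sigma$, for some Bochner integrable $g:\Omega\to X$.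
   Formalization: The case p = 1, I = [0,∞) is excluded: there Ces_1[0,∞) = {0}, which is a dual space and has the Radon-Nikodym property, so the claim as stated fails in that single case. *)

theory Defs
  imports "HOL-Analysis.Analysis"
begin

section \<open>Lebesgue measurable functions modulo equality almost everywhere\<close>

quotient_type lfun = "real \<Rightarrow> real" / partial:
  "\<lambda>f g. f \<in> borel_measurable lebesgue \<and> g \<in> borel_measurable lebesgue \<and>
         (AE x in lebesgue. f x = g x)"
proof (rule part_equivpI)
  show "\<exists>f::real \<Rightarrow> real. f \<in> borel_measurable lebesgue \<and> f \<in> borel_measurable lebesgue \<and>
      (AE x in lebesgue. f x = f x)"
    by (intro exI[of _ "\<lambda>_. 0"]) auto
qed (auto intro!: sympI transpI)

instantiation lfun :: real_vector
begin

lift_definition zero_lfun :: lfun is "\<lambda>_. 0"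
  by auto

lift_definition plus_lfun :: "lfun \<Rightarrow> lfun \<Rightarrow> lfun" is "\<lambda>f g x. f x + g x"
  by (auto elim: eventually_elim2)

lift_definition minus_lfun :: "lfun \<Rightarrow> lfun \<Rightarrow> lfun" is "\<lambda>f g x. f x - g x"
  by (auto elim: eventually_elim2)

lift_definition uminus_lfun :: "lfun \<Rightarrow> lfun" is "\<lambda>f x. - f x"
  by auto

lift_definition scaleR_lfun :: "real \<Rightarrow> lfun \<Rightarrow> lfun" is "\<lambda>c f x. c * f x"
  by (auto intro: borel_measurable_times elim: eventually_mono)

instance
  by standard (transfer; auto simp: algebra_simps)+

end

section \<open>Cesaro function spaces\<close>

(* The power of an extended real with exponent p > 0. *)
definition ennpowr :: "ennreal \<Rightarrow> real \<Rightarrow> ennreal" where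
  "ennpowr a p = (if a = \<infinity> then \<infinity> else ennreal (enn2real a powr p))"

(* The inner integral may be infinite: for I = {0..1} and x = 1 this happens for members of the
   space, while the outer integral is finite. *)
definition cesaro_integral :: "real \<Rightarrow> real set \<Rightarrow> (real \<Rightarrow> real) \<Rightarrow> ennreal" where
  "cesaro_integral p I f =
     (\<integral>\<^sup>+x\<in>I. ennpowr ((\<integral>\<^sup>+t\<in>{0..x}. ennreal \<bar>f t\<bar> \<partial>lebesgue) / ennreal x) p \<partial>lebesgue)"

lift_definition ces_integral :: "real \<Rightarrow> real set \<Rightarrow> lfun \<Rightarrow> ennreal" is cesaro_integral
proof -
  fix p I and f g :: "real \<Rightarrow> real"
  assume "f \<in> borel_measurable lebesgue \<and> g \<in> borel_measurable lebesgue \<and>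
    (AE x in lebesgue. f x = g x)"
  then have "AE x in lebesgue. f x = g x" by simp
  then have "(\<integral>\<^sup>+t\<in>{0..x}. ennreal \<bar>f t\<bar> \<partial>lebesgue) = (\<integral>\<^sup>+t\<in>{0..x}. ennreal \<bar>g t\<bar> \<partial>lebesgue)" for x
    by (intro nn_integral_cong_AE) (auto elim: eventually_mono)
  then show "cesaro_integral p I f = cesaro_integral p I g"
    by (simp add: cesaro_integral_def)
qed

lift_definition vanishes_off :: "real set \<Rightarrow> lfun \<Rightarrow> bool" is
  "\<lambda>I f. AE x in lebesgue. x \<notin> I \<longrightarrow> f x = 0"
proof -
  fix I and f g :: "real \<Rightarrow> real"
  assume "f \<in> borel_measurable lebesgue \<and> g \<in> borel_measurable lebesgue \<and>
    (AE x in lebesgue. f x = g x)"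
  then have "AE x in lebesgue. f x = g x" by simp
  then show "(AE x in lebesgue. x \<notin> I \<longrightarrow> f x = 0) = (AE x in lebesgue. x \<notin> I \<longrightarrow> g x = 0)"
    by (intro AE_cong_simp[OF refl] eventually_subst) (auto elim: eventually_mono)
qed

(* A function on I is identified with its extension by 0 to the real line. *)
definition Ces :: "real \<Rightarrow> real set \<Rightarrow> lfun set" where
  "Ces p I = {f. vanishes_off I f \<and> ces_integral p I f < \<infinity>}"

definition ces_norm :: "real \<Rightarrow> real set \<Rightarrow> lfun \<Rightarrow> real" where
  "ces_norm p I f = enn2real (ces_integral p I f) powr (1 / p)"

section \<open>Dual spaces and the Radon-Nikodym property\<close>

(* As the spaces Ces p I depend on the real number p, they are not types. A normed space is
   therefore given by a subspace V of a real vector space together with a norm N on V; the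
   values of N outside V are irrelevant. *)

definition linear_homeomorphism ::
    "'a::real_vector set \<Rightarrow> ('a \<Rightarrow> real) \<Rightarrow> ('a \<Rightarrow> 'b::real_normed_vector) \<Rightarrow> bool" where
  "linear_homeomorphism V N T \<longleftrightarrow>
     (\<forall>x\<in>V. \<forall>y\<in>V. T (x + y) = T x + T y) \<and>
     (\<forall>c. \<forall>x\<in>V. T (c *\<^sub>R x) = c *\<^sub>R T x) \<and>
     bij_betw T V UNIV \<and>
     (\<exists>C. \<forall>x\<in>V. norm (T x) \<le> C * N x) \<and>
     (\<exists>C. \<forall>x\<in>V. N x \<le> C * norm (T x))"

definition isomorphic_to_dual_of ::
    "'a::real_vector set \<Rightarrow> ('a \<Rightarrow> real) \<Rightarrow> 'y::banach itself \<Rightarrow> bool" where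
  "isomorphic_to_dual_of V N (_ :: 'y itself) \<longleftrightarrow>
     (\<exists>T :: 'a \<Rightarrow> ('y \<Rightarrow>\<^sub>L real). linear_homeomorphism V N T)"

definition vector_measure ::
    "'a::real_vector set \<Rightarrow> ('a \<Rightarrow> real) \<Rightarrow> 'w measure \<Rightarrow> ('w set \<Rightarrow> 'a) \<Rightarrow> bool" where
  "vector_measure V N M G \<longleftrightarrow>
     G \<in> sets M \<rightarrow> V \<and>
     (\<forall>A :: nat \<Rightarrow> 'w set. range A \<subseteq> sets M \<longrightarrow> disjoint_family A \<longrightarrow>
        (\<lambda>n. N ((\<Sum>i<n. G (A i)) - G (\<Union>i. A i))) \<longlonglongrightarrow> 0)"

definition continuous_wrt ::
    "('a::real_vector \<Rightarrow> real) \<Rightarrow> 'w measure \<Rightarrow> ('w set \<Rightarrow> 'a) \<Rightarrow> bool" where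
  "continuous_wrt N M G \<longleftrightarrow>
     (\<forall>\<epsilon>>0. \<exists>\<delta>>0. \<forall>E\<in>sets M. measure M E < \<delta> \<longrightarrow> N (G E) < \<epsilon>)"

definition bounded_variation ::
    "('a::real_vector \<Rightarrow> real) \<Rightarrow> 'w measure \<Rightarrow> ('w set \<Rightarrow> 'a) \<Rightarrow> bool" where
  "bounded_variation N M G \<longleftrightarrow>
     (\<exists>B. \<forall>P. finite P \<longrightarrow> P \<subseteq> sets M \<longrightarrow> partition_on (space M) P \<longrightarrow> (\<Sum>E\<in>P. N (G E)) \<le> B)"

definition strongly_measurable ::
    "'a::real_vector set \<Rightarrow> ('a \<Rightarrow> real) \<Rightarrow> 'w measure \<Rightarrow> ('w \<Rightarrow> 'a) \<Rightarrow> bool" where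
  "strongly_measurable V N M g \<longleftrightarrow>
     g \<in> space M \<rightarrow> V \<and>
     (\<exists>s :: nat \<Rightarrow> 'w \<Rightarrow> 'a. (\<forall>i. simple_function M (s i) \<and> s i \<in> space M \<rightarrow> V) \<and>
        (AE w in M. (\<lambda>i. N (g w - s i w)) \<longlonglongrightarrow> 0))"

(* The library's has_bochner_integral is confined to types of class real_normed_vector and
   second_countable_topology; this is its counterpart for a normed space (V, N). *)
definition has_bochner_integral_in ::
    "'a::real_vector set \<Rightarrow> ('a \<Rightarrow> real) \<Rightarrow> 'w measure \<Rightarrow> ('w \<Rightarrow> 'a) \<Rightarrow> 'a \<Rightarrow> bool" where
  "has_bochner_integral_in V N M g v \<longleftrightarrow>
     strongly_measurable V N M g \<and> v \<in> V \<and>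
     (\<exists>s :: nat \<Rightarrow> 'w \<Rightarrow> 'a.
        (\<forall>i. Bochner_Integration.simple_bochner_integrable M (s i) \<and> s i \<in> space M \<rightarrow> V) \<and>
        (\<lambda>i. \<integral>\<^sup>+w. ennreal (N (g w - s i w)) \<partial>M) \<longlonglongrightarrow> 0 \<and>
        (\<lambda>i. N (Bochner_Integration.simple_bochner_integral M (s i) - v)) \<longlonglongrightarrow> 0)"

(* The type argument fixes the type of the points of the measure spaces. A space that fails
   the property for one such type fails the unrestricted property. *)
definition radon_nikodym_property ::
    "'w itself \<Rightarrow> 'a::real_vector set \<Rightarrow> ('a \<Rightarrow> real) \<Rightarrow> bool" where
  "radon_nikodym_property (_ :: 'w itself) V N \<longleftrightarrow>
     (\<forall>(M :: 'w measure) G. finite_measure M \<longrightarrow> vector_measure V N M G \<longrightarrow>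
        continuous_wrt N M G \<longrightarrow> bounded_variation N M G \<longrightarrow>
        (\<exists>g. \<forall>E\<in>sets M. has_bochner_integral_in V N M (\<lambda>w. indicator E w *\<^sub>R g w) (G E)))"

section \<open>The degenerate case\<close>

(* The zero space is a dual space and has the Radon-Nikodym property, so non-duality and failure
   of the property can only be claimed away from p = 1, I = {0..}. *)
lemma Ces_1_atLeast_0: "Ces 1 {0..} = {0}"
proof -
  have zero: "f = 0" if van: "vanishes_off {0..} f" and fin: "ces_integral 1 {0..} f < \<infinity>" for f
    using that
  proof transfer
    fix f :: "real \<Rightarrow> real"
    assume "f \<in> borel_measurable lebesgue \<and> f \<in> borel_measurable lebesgue \<and>
      (AE x in lebesgue. f x = f x)"
    then have [measurable]: "f \<in> borel_measurable lebesgue" by simp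
    assume off: "AE x in lebesgue. x \<notin> {0..} \<longrightarrow> f x = 0"
      and fin: "cesaro_integral 1 {0..} f < \<infinity>"
    define F where "F x = (\<integral>\<^sup>+t\<in>{0..x}. ennreal \<bar>f t\<bar> \<partial>lebesgue)" for x
    have F0: "F (real n) = 0" for n
    proof (rule ccontr)
      assume "F (real n) \<noteq> 0"
      then obtain c where c: "0 < c" "ennreal c \<le> F (real n)"
        by (metis ennreal_0 ennreal_cases ennreal_le_iff2 le_less linorder_not_le order_refl 
            ennreal_top_neq_zero top_greatest zero_less_one)
      have n: "n > 0"
      proof (rule ccontr)
        assume "\<not> 0 < n"
        then have "F (real n) = (\<integral>\<^sup>+t\<in>{0}. ennreal \<bar>f t\<bar> \<partial>lebesgue)" by (simp add: F_def)
        also have "\<dots> = 0" by (subst nn_integral_indicator_singleton) auto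
        finally show False using \<open>F (real n) \<noteq> 0\<close> by simp
      qed
      have mono: "F x \<ge> ennreal c" if "real n \<le> x" for x
        using that unfolding F_def
        by (intro order_trans[OF c(2)[unfolded F_def]] nn_integral_mono) (auto split: split_indicator)
      have pw: "ennreal (c / x) \<le> ennpowr (F x / ennreal x) 1" if "real n \<le> x" for x
      proof -
        have "x > 0" using that n by linarith
        then have "ennreal (c / x) = ennreal c / ennreal x"
          using c by (simp add: divide_ennreal)
        also have "\<dots> \<le> F x / ennreal x"
          using mono[OF that] by (intro divide_right_mono_ennreal)
        also have "\<dots> = ennpowr (F x / ennreal x) 1"
          by (auto simp: ennpowr_def enn2real_nonneg less_top)
        finally show ?thesis .
      qed
      have bound: "ennreal (c * (ln b - ln (real n))) \<le> cesaro_integral 1 {0..} f"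
        if "b \<ge> real n" for b
      proof -
        have "ennreal (c * ln b - c * ln (real n)) =
            (\<integral>\<^sup>+x. ennreal (c / x) * indicator {real n..b} x \<partial>lborel)"
          using n c that
          by (intro nn_integral_FTC_Icc[symmetric])
            (auto intro!: derivative_eq_intros simp: field_simps has_real_derivative_iff_has_vector_derivative[symmetric])
        also have "\<dots> = (\<integral>\<^sup>+x. ennreal (c / x) * indicator {real n..b} x \<partial>lebesgue)"
          by (intro nn_integral_completion[symmetric]) 
        also have "\<dots> \<le> cesaro_integral 1 {0..} f"
          unfolding cesaro_integral_def F_def[symmetric]
          by (intro nn_integral_mono) (use n pw in \<open>auto split: split_indicator\<close>)
        finally show ?thesis by (simp add: algebra_simps)
      qed
      obtain K where K: "K \<ge> 0" "cesaro_integral 1 {0..} f = ennreal K"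
        using fin by (cases "cesaro_integral 1 {0..} f") auto
      define b where "b = exp (ln (real n) + (K + 1) / c)"
      have "b \<ge> real n"
      proof -
        have "exp (ln (real n)) \<le> b" unfolding b_def using K c by simp
        then show ?thesis using n by simp
      qed
      from bound[OF this] K have "c * (ln b - ln (real n)) \<le> K" by simp
      then show False using c by (simp add: b_def)
    qed
    have "AE t in lebesgue. t \<in> {0..real n} \<longrightarrow> f t = 0" for n
    proof -
      have "(\<lambda>t. ennreal \<bar>f t\<bar> * indicator {0..real n} t) \<in> borel_measurable lebesgue"
        by (intro borel_measurable_times_ennreal borel_measurable_indicator measurable_compose[OF _ measurable_ennreal]
            borel_measurable_abs) auto
      from iffD1[OF nn_integral_0_iff_AE[OF this] F0[of n, unfolded F_def]] show ?thesis
        by (auto elim!: eventually_mono simp: indicator_def)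
    qed
    then have "AE t in lebesgue. \<forall>n. t \<in> {0..real n} \<longrightarrow> f t = 0"
      by (subst AE_all_countable) blast
    with off have "AE t in lebesgue. f t = 0"
    proof eventually_elim
      case (elim t)
      then show ?case using real_arch_simple[of t] by (cases "t \<ge> 0") auto
    qed
    then show "f \<in> borel_measurable lebesgue \<and> (\<lambda>_. 0::real) \<in> borel_measurable lebesgue \<and>
        (AE x in lebesgue. f x = 0)"
      by simp
  qed
  have "vanishes_off {0..} 0" by transfer simp
  moreover have "ces_integral 1 {0..} 0 < \<infinity>"
    by transfer (simp add: cesaro_integral_def ennpowr_def)
  ultimately show ?thesis
    using zero by (auto simp: Ces_def)
qed

end

theory Submission
  imports Defs
begin

text \<open>
  Functions supported in the interval \<open>W = {1/4<..1/2}\<close> inside \<open>I\<close> form a copy of \<open>L\<^sup>1\<close> in \<open>Ces p I\<close>.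
  The vector measure sending \<open>E \<subseteq> W\<close> to the class of its indicator function has no density, so the
  Radon-Nikodym property fails. If \<open>Ces p I\<close> were the dual of \<open>Y\<close>, then, as \<open>Ces p I\<close> is separable,
  the weak* closure \<open>K\<close> of the set of all bounded probability densities on \<open>W\<close> would be a weak*
  compact set covered by countably many small norm balls. By Baire's theorem some density \<open>f\<close> has a
  weak* neighbourhood which meets the densities in a set of small diameter. But \<open>f\<close> multiplied by
  \<open>1 + r/2\<close>, with a rapidly oscillating sign \<open>r\<close>, is a density (up to a small correction) that is
  weak* close to \<open>f\<close> and at a fixed distance from it.
\<close>

section \<open>Classes of measurable functions\<close>

text \<open>A copy of L1 alone does not rule out a dual space: the dual of C[0,1] contains one.
  Separability of the whole space makes it fatal, because a separable dual has the Radon-Nikodym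
  property, and this property passes to closed subspaces. The argument for (a) works with the
  geometric fact behind that theorem: in a separable dual, a nonempty bounded set has a point with a
  weak* neighbourhood that cuts out a piece of small diameter, whereas the probability densities
  have no such point. The factor \<open>1 + r/2\<close> only takes the values 1/2 and 3/2, so it
  keeps a density nonnegative and still moves it by half of its mass in L1. Only the integral may
  change, by half the integral of \<open>f * r\<close>; treating integration as one more functional
  to be made small keeps this change under control, and a small multiple of \<open>f\<close> undoes
  it. Both parts reach the Cesaro norm through just two inequalities, which compare it on the window
  with the L1 norm from above and from below.\<close>

lemma lfun_eq_abs:
  fixes F :: lfun
  obtains f where "f \<in> borel_measurable lebesgue" "F = abs_lfun f"
  by (induction F rule: lfun.abs_induct) auto

lemma rep_lfun_measurable [measurable]: "rep_lfun F \<in> borel_measurable lebesgue"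
  using Quotient3_rep_reflp[OF Quotient3_lfun, of F] by simp

lemma abs_rep_lfun: "abs_lfun (rep_lfun F) = F"
  by (rule Quotient3_abs_rep[OF Quotient3_lfun])

lemma
  assumes [measurable]: "f \<in> borel_measurable lebesgue"
  shows abs_lfun_scaleR: "c *\<^sub>R abs_lfun f = abs_lfun (\<lambda>x. c * f x)"
    and ces_integral_abs: "ces_integral p I (abs_lfun f) = cesaro_integral p I f"
    and vanishes_off_abs: "vanishes_off I (abs_lfun f) \<longleftrightarrow> (AE x in lebesgue. x \<notin> I \<longrightarrow> f x = 0)"
  by (auto intro!: scaleR_lfun.abs_eq ces_integral.abs_eq vanishes_off.abs_eq)

lemma
  assumes [measurable]: "f \<in> borel_measurable lebesgue" "g \<in> borel_measurable lebesgue"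
  shows abs_lfun_add: "abs_lfun f + abs_lfun g = abs_lfun (\<lambda>x. f x + g x)"
    and abs_lfun_diff: "abs_lfun f - abs_lfun g = abs_lfun (\<lambda>x. f x - g x)"
  by (auto intro!: plus_lfun.abs_eq minus_lfun.abs_eq)

text \<open>The L1 seminorm over \<open>J\<close>. Values in \<open>ennreal\<close> make it total on
  classes, so that subadditivity and homogeneity hold without integrability conditions;
  \<open>mass W\<close> is the quantity in which the failure of the Radon-Nikodym property is
  measured.\<close>

lift_definition mass :: "real set \<Rightarrow> lfun \<Rightarrow> ennreal" is
  "\<lambda>J f. \<integral>\<^sup>+t\<in>J. ennreal \<bar>f t\<bar> \<partial>lebesgue"
  by (intro nn_integral_cong_AE) (auto elim: eventually_mono)

lemma mass_abs:
  "f \<in> borel_measurable lebesgue \<Longrightarrow> mass J (abs_lfun f) = (\<integral>\<^sup>+t\<in>J. ennreal \<bar>f t\<bar> \<partial>lebesgue)"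
  by (auto intro: mass.abs_eq)

lemma mass_zero [simp]: "mass J 0 = 0"
  by (simp add: zero_lfun.abs_eq mass_abs)

lemma mass_mono: "J \<subseteq> J' \<Longrightarrow> mass J F \<le> mass J' F"
  by (transfer, intro nn_integral_mono) (auto split: split_indicator)

lemma mass_add_le: "J \<in> sets lebesgue \<Longrightarrow> mass J (F + G) \<le> mass J F + mass J G"
proof (transfer, clarsimp)
  fix J :: "real set" and f g :: "real \<Rightarrow> real"
  assume [measurable]: "J \<in> sets lebesgue" "f \<in> borel_measurable lebesgue" "g \<in> borel_measurable lebesgue"
  have "(\<integral>\<^sup>+t\<in>J. ennreal \<bar>f t + g t\<bar> \<partial>lebesgue)
      \<le> (\<integral>\<^sup>+t. (ennreal \<bar>f t\<bar> * indicator J t + ennreal \<bar>g t\<bar> * indicator J t) \<partial>lebesgue)"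
    by (intro nn_integral_mono) (auto split: split_indicator simp flip: ennreal_plus)
  also have "\<dots> = (\<integral>\<^sup>+t\<in>J. ennreal \<bar>f t\<bar> \<partial>lebesgue) + (\<integral>\<^sup>+t\<in>J. ennreal \<bar>g t\<bar> \<partial>lebesgue)"
    by (rule nn_integral_add) auto
  finally show "(\<integral>\<^sup>+t\<in>J. ennreal \<bar>f t + g t\<bar> \<partial>lebesgue)
      \<le> (\<integral>\<^sup>+t\<in>J. ennreal \<bar>f t\<bar> \<partial>lebesgue) + (\<integral>\<^sup>+t\<in>J. ennreal \<bar>g t\<bar> \<partial>lebesgue)" .
qed

lemma mass_scaleR:
  assumes "J \<in> sets lebesgue" shows "mass J (c *\<^sub>R F) = ennreal \<bar>c\<bar> * mass J F"
  using assms
proof (transfer, clarsimp)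
  fix J :: "real set" and c and f :: "real \<Rightarrow> real"
  assume [measurable]: "J \<in> sets lebesgue" "f \<in> borel_measurable lebesgue"
  show "(\<integral>\<^sup>+t\<in>J. ennreal \<bar>c * f t\<bar> \<partial>lebesgue) = ennreal \<bar>c\<bar> * (\<integral>\<^sup>+t\<in>J. ennreal \<bar>f t\<bar> \<partial>lebesgue)"
    by (subst nn_integral_cmult[symmetric]) (auto simp: abs_mult ennreal_mult mult.assoc)
qed

lemma mass_minus: "J \<in> sets lebesgue \<Longrightarrow> mass J (- F) = mass J F"
  using mass_scaleR[of J "-1" F] by simp

lemma mass_triangle: "J \<in> sets lebesgue \<Longrightarrow> mass J (F - H) \<le> mass J (F - G) + mass J (G - H)"
  using mass_add_le[of J "F - G" "G - H"] by simp

lemma mass_diff_commute: "J \<in> sets lebesgue \<Longrightarrow> mass J (F - G) = mass J (G - F)"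
  using mass_minus[of J "F - G"] by simp

lemma mass_sum_le:
  assumes "J \<in> sets lebesgue"
  shows "mass J (\<Sum>i\<in>A. F i) \<le> (\<Sum>i\<in>A. mass J (F i))"
proof (induction A rule: infinite_finite_induct)
  case (insert a A)
  then show ?case
    using mass_add_le[OF assms, of "F a" "sum F A"] by (auto intro: order_trans add_left_mono)
qed auto

section \<open>Estimates for the Cesaro integral\<close>

lemma ennpowr_mono: "0 \<le> p \<Longrightarrow> a \<le> b \<Longrightarrow> ennpowr a p \<le> ennpowr b p"
  by (auto simp: ennpowr_def less_top intro!: ennreal_leI powr_mono2 enn2real_mono top.extremum_uniqueI)

lemma ennpowr_measurable [measurable]: "(\<lambda>a. ennpowr a p) \<in> borel_measurable borel"
  unfolding ennpowr_def by measurable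

lemma ennpowr_eq_top [simp]: "ennpowr a p = top \<longleftrightarrow> a = top"
  by (simp add: ennpowr_def)

lemma ennpowr_mult:
  assumes "0 < c" shows "ennpowr (ennreal c * a) p = ennreal (c powr p) * ennpowr a p"
  using assms
  by (cases a) (auto simp: ennpowr_def ennreal_mult[symmetric] powr_mult ennreal_mult_top ennreal_mult_eq_top_iff)

text \<open>Comes from \<open>a + b \<le> 2 * max a b\<close>. The loss of the factor
  \<open>2 powr p\<close> is harmless, since the estimate serves to show finiteness and to combine
  errors that can be made arbitrarily small.\<close>

lemma ennpowr_add_le:
  assumes "0 \<le> p" shows "ennpowr (a + b) p \<le> ennreal (2 powr p) * (ennpowr a p + ennpowr b p)"
proof -
  have "ennpowr (a + b) p \<le> ennpowr (2 * max a b) p"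
    using assms by (intro ennpowr_mono) (auto simp: mult_2 max_def intro: add_mono)
  also have "\<dots> = ennreal (2 powr p) * ennpowr (max a b) p"
    using ennpowr_mult[of 2 "max a b"] by simp
  also have "\<dots> \<le> ennreal (2 powr p) * (ennpowr a p + ennpowr b p)"
    by (intro mult_left_mono) (auto simp: max_def)
  finally show ?thesis .
qed

lemma ennpowr_tendsto_0:
  assumes "0 < p" "(u \<longlongrightarrow> 0) F" shows "((\<lambda>i. ennpowr (u i) p) \<longlongrightarrow> 0) F"
proof -
  have fin: "eventually (\<lambda>i. u i < top) F"
    using assms(2) by (rule order_tendstoD) simp
  have "((\<lambda>i. enn2real (u i)) \<longlongrightarrow> 0) F"
    using assms(2) by (intro tendsto_enn2real) auto
  then have "((\<lambda>i. enn2real (u i) powr p) \<longlongrightarrow> 0 powr p) F"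
    using assms(1) by (intro tendsto_powr2 tendsto_const) auto
  then have "((\<lambda>i. ennreal (enn2real (u i) powr p)) \<longlongrightarrow> 0) F"
    using tendsto_ennrealI by fastforce
  then show ?thesis
    by (rule Lim_transform_eventually) (use fin in \<open>auto simp: ennpowr_def elim: eventually_mono\<close>)
qed

definition primitive :: "(real \<Rightarrow> real) \<Rightarrow> real \<Rightarrow> ennreal" where
  "primitive f x = (\<integral>\<^sup>+t\<in>{0..x}. ennreal \<bar>f t\<bar> \<partial>lebesgue)"

lemma cesaro_integral_eq:
  "cesaro_integral p I f = (\<integral>\<^sup>+x\<in>I. ennpowr (primitive f x / ennreal x) p \<partial>lebesgue)"
  by (simp add: cesaro_integral_def primitive_def)

lemma mono_primitive: "mono (primitive f)"
  unfolding primitive_def by (intro monoI nn_integral_mono) (auto split: split_indicator)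

text \<open>Superlevel sets of a monotone function are intervals. This gives Borel measurability for
  arbitrary \<open>f\<close>.\<close>

lemma primitive_measurable [measurable]: "primitive f \<in> borel_measurable borel"
proof (rule borel_measurableI_greater)
  fix y
  have "is_interval {x. y < primitive f x}"
    using mono_primitive[of f] by (auto simp: is_interval_1 mono_def intro: less_le_trans)
  then show "{x \<in> space borel. y < primitive f x} \<in> sets borel"
    using real_interval_borel_measurable by simp
qed

lemma average_measurable [measurable]:
  "(\<lambda>x. ennpowr (primitive f x / ennreal x) p) \<in> borel_measurable lebesgue"
  by (rule measurable_completion) measurable

lemma primitive_mono:
  assumes "AE x in lebesgue. \<bar>f x\<bar> \<le> \<bar>g x\<bar>" shows "primitive f x \<le> primitive g x"
  unfolding primitive_def
  by (rule nn_integral_mono_AE) (use assms in eventually_elim, auto split: split_indicator)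

lemma primitive_add_le:
  assumes [measurable]: "f \<in> borel_measurable lebesgue" "g \<in> borel_measurable lebesgue"
  shows "primitive (\<lambda>x. f x + g x) x \<le> primitive f x + primitive g x"
  using mass_add_le[of "{0..x}" "abs_lfun f" "abs_lfun g"]
  by (simp add: abs_lfun_add mass_abs primitive_def)

lemma primitive_mult:
  assumes [measurable]: "f \<in> borel_measurable lebesgue"
  shows "primitive (\<lambda>x. c * f x) x = ennreal \<bar>c\<bar> * primitive f x"
  using mass_scaleR[of "{0..x}" c "abs_lfun f"]
  by (simp add: abs_lfun_scaleR mass_abs primitive_def)

lemma cesaro_integral_add_le:
  assumes p: "0 \<le> p" and [measurable]: "I \<in> sets lebesgue"
    "f \<in> borel_measurable lebesgue" "g \<in> borel_measurable lebesgue"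
  shows "cesaro_integral p I (\<lambda>x. f x + g x)
     \<le> ennreal (2 powr p) * (cesaro_integral p I f + cesaro_integral p I g)"
proof -
  have "cesaro_integral p I (\<lambda>x. f x + g x) \<le> (\<integral>\<^sup>+x\<in>I. (ennreal (2 powr p) *
      (ennpowr (primitive f x / ennreal x) p + ennpowr (primitive g x / ennreal x) p)) \<partial>lebesgue)"
    unfolding cesaro_integral_eq
  proof (intro nn_integral_mono mult_right_mono)
    fix x
    have "ennpowr (primitive (\<lambda>x. f x + g x) x / ennreal x) p
        \<le> ennpowr (primitive f x / ennreal x + primitive g x / ennreal x) p"
      by (auto intro!: ennpowr_mono p divide_right_mono_ennreal primitive_add_le 
            simp flip: add_divide_distrib_ennreal)
    also have "\<dots> \<le> ennreal (2 powr p) *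
      (ennpowr (primitive f x / ennreal x) p + ennpowr (primitive g x / ennreal x) p)"
      by (rule ennpowr_add_le[OF p])
    finally show "ennpowr (primitive (\<lambda>x. f x + g x) x / ennreal x) p
      \<le> ennreal (2 powr p) *
      (ennpowr (primitive f x / ennreal x) p + ennpowr (primitive g x / ennreal x) p)" .
  qed auto
  also have "\<dots> = ennreal (2 powr p) * (cesaro_integral p I f + cesaro_integral p I g)"
    unfolding cesaro_integral_eq
    by (subst nn_integral_add[symmetric], measurable, subst nn_integral_cmult[symmetric], measurable)
       (auto simp: algebra_simps)
  finally show ?thesis .
qed

lemma cesaro_integral_mult:
  assumes "0 < p" and [measurable]: "I \<in> sets lebesgue" "f \<in> borel_measurable lebesgue"
  shows "cesaro_integral p I (\<lambda>x. c * f x) = ennreal (\<bar>c\<bar> powr p) * cesaro_integral p I f"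
proof (cases "c = 0")
  case True
  then show ?thesis using assms by (simp add: cesaro_integral_def ennpowr_def)
next
  case False
  then show ?thesis unfolding cesaro_integral_eq
    by (subst nn_integral_cmult[symmetric], measurable)
       (simp add: primitive_mult ennpowr_mult flip: ennreal_times_divide mult.assoc)
qed

lemma cesaro_integral_zero: "cesaro_integral p I (\<lambda>_. 0) = 0"
  by (simp add: cesaro_integral_def ennpowr_def)

text \<open>Dominated convergence is applied twice: to the inner integral at each \<open>x\<close>
  where the average of \<open>h\<close> is finite, which is almost every point of \<open>I\<close>,
  and then to the outer integral, where the powers of the averages of \<open>h\<close>
  dominate.\<close>

lemma cesaro_integral_dominated:
  assumes p: "0 < p" and [measurable]: "I \<in> sets lebesgue" "h \<in> borel_measurable lebesgue"
    "\<And>n. u n \<in> borel_measurable lebesgue"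
    and fin: "cesaro_integral p I h < \<infinity>"
    and bound: "\<And>n. AE x in lebesgue. \<bar>u n x\<bar> \<le> \<bar>h x\<bar>"
    and lim: "AE x in lebesgue. (\<lambda>n. u n x) \<longlonglongrightarrow> 0"
  shows "(\<lambda>n. cesaro_integral p I (u n)) \<longlonglongrightarrow> 0"
proof -
  let ?a = "\<lambda>f x. ennpowr (primitive f x / ennreal x) p * indicator I x"
  have fin': "AE x in lebesgue. ?a h x \<noteq> top"
    using nn_integral_PInf_AE[of "?a h" lebesgue] fin by (simp add: cesaro_integral_eq)
  have "(\<lambda>n. \<integral>\<^sup>+x. ?a (u n) x \<partial>lebesgue) \<longlonglongrightarrow> (\<integral>\<^sup>+x. 0 \<partial>(lebesgue :: real measure))"
  proof (rule nn_integral_dominated_convergence[where w = "?a h"])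
    show "(\<integral>\<^sup>+x. ?a h x \<partial>lebesgue) < \<infinity>"
      using fin by (simp add: cesaro_integral_eq)
    show "AE x in lebesgue. ?a (u n) x \<le> ?a h x" for n
      using p by (intro AE_I2 mult_right_mono ennpowr_mono divide_right_mono_ennreal primitive_mono bound) auto
    show "AE x in lebesgue. (\<lambda>n. ?a (u n) x) \<longlonglongrightarrow> 0"
      using fin'
    proof eventually_elim
      case (elim x)
      show ?case
      proof (cases "x \<in> I")
        case True
        with elim have ne: "primitive h x / ennreal x \<noteq> top" by simp
        have "(\<lambda>n. primitive (u n) x / ennreal x) \<longlonglongrightarrow> 0"
        proof (cases "primitive h x = 0")
          case True
          then have "primitive (u n) x = 0" for n
            using primitive_mono[OF bound, of n x] by simp
          then show ?thesis by simp
        next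
          case False
          \<comment> \<open>For \<open>x \<le> 0\<close> the denominator is 0, and a nonzero value
            divided by 0 is \<open>top\<close>. Finiteness of the quotient therefore forces
            \<open>x > 0\<close>; the excluded case \<open>primitive h x = 0\<close> was treated
            apart because 0 / 0 is 0.\<close>
          with ne have x: "x > 0" and "primitive h x \<noteq> top"
            by (auto simp: ennreal_divide_eq_top_iff not_le[symmetric] ennreal_neg)
          have [measurable]: "{0..x} \<in> sets lebesgue" by simp
          from \<open>primitive h x \<noteq> top\<close> have "primitive h x < \<infinity>" by (simp add: less_top)
          have "(\<lambda>n. primitive (u n) x) \<longlonglongrightarrow> (\<integral>\<^sup>+x. 0 \<partial>(lebesgue :: real measure))"
            unfolding primitive_def
          proof (rule nn_integral_dominated_convergence[where w = "\<lambda>t. ennreal \<bar>h t\<bar> * indicator {0..x} t"])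
            show "(\<integral>\<^sup>+t. ennreal \<bar>h t\<bar> * indicator {0..x} t \<partial>lebesgue) < \<infinity>"
              using \<open>primitive h x < \<infinity>\<close> by (simp add: primitive_def)
            show "AE t in lebesgue. ennreal \<bar>u n t\<bar> * indicator {0..x} t \<le> ennreal \<bar>h t\<bar> * indicator {0..x} t" for n
              using bound[of n] by eventually_elim (auto split: split_indicator)
            show "AE t in lebesgue. (\<lambda>n. ennreal \<bar>u n t\<bar> * indicator {0..x} t) \<longlonglongrightarrow> 0"
              using lim
            proof eventually_elim
              case (elim t)
              then have "(\<lambda>n. ennreal \<bar>u n t\<bar>) \<longlonglongrightarrow> ennreal 0"
                by (intro tendsto_ennrealI tendsto_rabs_zero)
              then show ?case by (auto split: split_indicator)
            qed
          qed auto
          then have "(\<lambda>n. primitive (u n) x) \<longlonglongrightarrow> 0" by simp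
          then have "(\<lambda>n. ennreal (inverse x) * primitive (u n) x) \<longlonglongrightarrow> ennreal (inverse x) * 0"
            by (intro ennreal_tendsto_cmult) auto
          with x show ?thesis by (simp add: divide_ennreal_def inverse_ennreal mult.commute)
        qed
        from ennpowr_tendsto_0[OF p this] show ?thesis using True by simp
      qed simp
    qed
  qed auto
  then show ?thesis by (simp add: cesaro_integral_eq)
qed

section \<open>Cesaro function spaces\<close>

locale cesaro_space =
  fixes p :: real and I :: "real set"
  assumes p_ge_1: "1 \<le> p"
    and I_cases: "I = {0..1} \<or> I = {0..}"
    and not_degenerate: "\<not> (p = 1 \<and> I = {0..})"
begin

lemma p_pos: "0 < p"
  using p_ge_1 by simp

lemma I_measurable [measurable]: "I \<in> sets lebesgue"
  using I_cases by auto

lemma I_nonneg: "x \<in> I \<Longrightarrow> 0 \<le> x"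
  using I_cases by auto

lemma unit_interval_subset: "{0..1} \<subseteq> I"
  using I_cases by auto

lemma abs_lfun_in_Ces_iff:
  assumes "f \<in> borel_measurable lebesgue"
  shows "abs_lfun f \<in> Ces p I \<longleftrightarrow>
    (AE x in lebesgue. x \<notin> I \<longrightarrow> f x = 0) \<and> cesaro_integral p I f < \<infinity>"
  using assms by (simp add: Ces_def vanishes_off_abs ces_integral_abs)

lemma subspace_Ces: "subspace (Ces p I)"
proof (rule subspaceI)
  show "0 \<in> Ces p I"
    by (simp add: zero_lfun.abs_eq abs_lfun_in_Ces_iff cesaro_integral_zero)
next
  fix F G assume FG: "F \<in> Ces p I" "G \<in> Ces p I"
  obtain f g where [measurable]: "f \<in> borel_measurable lebesgue" "g \<in> borel_measurable lebesgue"
    and eq: "F = abs_lfun f" "G = abs_lfun g" by (metis lfun_eq_abs)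
  from FG have f: "AE x in lebesgue. x \<notin> I \<longrightarrow> f x = 0" "cesaro_integral p I f < \<infinity>"
    and g: "AE x in lebesgue. x \<notin> I \<longrightarrow> g x = 0" "cesaro_integral p I g < \<infinity>"
    by (simp_all add: eq abs_lfun_in_Ces_iff)
  have "AE x in lebesgue. x \<notin> I \<longrightarrow> f x + g x = 0"
    using f(1) g(1) by eventually_elim auto
  moreover have "cesaro_integral p I (\<lambda>x. f x + g x) < \<infinity>"
    using cesaro_integral_add_le[of p I f g] f(2) g(2) p_pos
    by (auto intro: le_less_trans simp: ennreal_mult_less_top)
  ultimately show "F + G \<in> Ces p I"
    by (simp add: eq abs_lfun_add abs_lfun_in_Ces_iff)
next
  fix c F assume F: "F \<in> Ces p I"
  obtain f where [measurable]: "f \<in> borel_measurable lebesgue" and eq: "F = abs_lfun f"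
    by (rule lfun_eq_abs)
  from F have f: "AE x in lebesgue. x \<notin> I \<longrightarrow> f x = 0" "cesaro_integral p I f < \<infinity>"
    by (simp_all add: eq abs_lfun_in_Ces_iff)
  have "AE x in lebesgue. x \<notin> I \<longrightarrow> c * f x = 0"
    using f(1) by eventually_elim auto
  moreover have "cesaro_integral p I (\<lambda>x. c * f x) < \<infinity>"
    using f(2) p_pos by (auto simp: cesaro_integral_mult ennreal_mult_less_top)
  ultimately show "c *\<^sub>R F \<in> Ces p I"
    by (simp add: eq abs_lfun_scaleR abs_lfun_in_Ces_iff)
qed

lemma ces_norm_nonneg: "0 \<le> ces_norm p I F"
  by (simp add: ces_norm_def)

text \<open>The p-th power of the Cesaro norm of a unit point mass at \<open>a\<close>, whose
  average at \<open>x \<ge> a\<close> is \<open>1 / x\<close>. Moving mass to the right only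
  decreases the norm, so this bounds every unit mass carried by the points beyond
  \<open>a\<close>.\<close>

definition tail :: "real \<Rightarrow> ennreal" where
  "tail a = (\<integral>\<^sup>+x\<in>I \<inter> {a..}. ennreal (x powr - p) \<partial>lebesgue)"

text \<open>On the unit interval the integrand is at most \<open>a powr - p\<close>. On the
  half-line \<open>p > 1\<close> makes \<open>x powr - p\<close> integrable at infinity; this is
  where the degenerate case has to be excluded.\<close>

lemma tail_finite:
  assumes "0 < a" shows "tail a < \<infinity>"
proof (cases "I = {0..1}")
  case True
  have "tail a \<le> (\<integral>\<^sup>+x. ennreal (a powr - p) * indicator {0..1::real} x \<partial>lebesgue)"
    unfolding tail_def using assms p_pos True
    by (intro nn_integral_mono) (auto split: split_indicator intro!: ennreal_leI powr_mono2')
  also have "\<dots> < \<infinity>" by (subst nn_integral_cmult_indicator) (auto simp: ennreal_mult_less_top)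
  finally show ?thesis .
next
  case False
  then have I: "I = {0..}" and p: "1 < p"
    using I_cases p_ge_1 not_degenerate by auto
  have lim: "((\<lambda>x. x powr (1 - p) / (1 - p)) \<longlongrightarrow> 0 / (1 - p)) at_top"
    using p by (intro tendsto_intros tendsto_neg_powr filterlim_ident) auto
  have deriv: "DERIV (\<lambda>x. x powr (1 - p) / (1 - p)) x :> x powr - p" if "a \<le> x" for x
    using DERIV_cdivide[OF has_real_derivative_powr[of x "1 - p"], of "1 - p"] that assms p by simp
  have "tail a = (\<integral>\<^sup>+x. ennreal (x powr - p) * indicator {a..} x \<partial>lborel)"
    unfolding tail_def using assms I
    by (subst nn_integral_completion[symmetric]) (auto intro!: nn_integral_cong split: split_indicator)
  also have "\<dots> = ennreal (0 / (1 - p) - a powr (1 - p) / (1 - p))"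
    using lim deriv by (intro nn_integral_FTC_atLeast) auto
  finally show ?thesis by simp
qed

text \<open>The averages of \<open>f\<close> vanish to the left of \<open>a\<close> and are at most
  \<open>Q / x\<close> from there on.\<close>

lemma cesaro_integral_le_tail:
  assumes a: "0 < a" and Q: "0 \<le> Q"
    and f: "AE x in lebesgue. x < a \<longrightarrow> f x = 0"
    and bound: "(\<integral>\<^sup>+x. ennreal \<bar>f x\<bar> \<partial>lebesgue) \<le> ennreal Q"
  shows "cesaro_integral p I f \<le> ennreal (Q powr p) * tail a"
proof -
  have prim: "primitive f x \<le> ennreal Q" for x
    by (rule order_trans[OF _ bound]) (auto simp: primitive_def intro!: nn_integral_mono split: split_indicator)
  have "primitive f x = 0" if "x < a" for x
  proof -
    have "primitive f x = (\<integral>\<^sup>+x. 0 \<partial>(lebesgue :: real measure))"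
      unfolding primitive_def
      by (rule nn_integral_cong_AE) (use f that in \<open>auto elim!: eventually_mono split: split_indicator\<close>)
    then show ?thesis by simp
  qed
  then have "ennpowr (primitive f x / ennreal x) p * indicator I x
      \<le> ennreal (Q powr p) * (ennreal (x powr - p) * indicator (I \<inter> {a..}) x)" for x
  proof (cases "x < a")
    case False
    then have x: "0 < x" using a by simp
    then have "ennpowr (primitive f x / ennreal x) p \<le> ennpowr (ennreal (Q / x)) p"
      using prim[of x] Q p_pos
      by (intro ennpowr_mono) (auto simp: divide_ennreal[symmetric] divide_right_mono_ennreal)
    also have "\<dots> = ennreal (Q powr p) * ennreal (x powr - p)"
      using x Q by (simp add: ennpowr_def powr_divide powr_minus_divide flip: ennreal_mult)
    finally show ?thesis using False by (auto split: split_indicator)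
  qed (simp add: ennpowr_def)
  then have "cesaro_integral p I f \<le>
      (\<integral>\<^sup>+x. ennreal (Q powr p) * (ennreal (x powr - p) * indicator (I \<inter> {a..}) x) \<partial>lebesgue)"
    unfolding cesaro_integral_eq by (intro nn_integral_mono)
  also have "\<dots> = ennreal (Q powr p) * tail a"
    unfolding tail_def
  proof (rule nn_integral_cmult)
    have [measurable]: "I \<inter> {a..} \<in> sets lebesgue" by (rule sets.Int) auto
    have [measurable]: "(\<lambda>x. ennreal (x powr - p)) \<in> borel_measurable lebesgue"
      by (rule measurable_completion) measurable
    show "(\<lambda>x. ennreal (x powr - p) * indicator (I \<inter> {a..}) x) \<in> borel_measurable lebesgue"
      by measurable
  qed
  finally show ?thesis .
qed

lemma cesaro_integral_bounded_support:
  assumes "0 < a" and f: "\<And>x. \<bar>f x\<bar> \<le> M * indicator {a..b} x"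
  shows "cesaro_integral p I f < \<infinity>"
proof -
  have supp: "f x = 0" if "x \<notin> {a..b}" for x
    using f[of x] that by simp
  have "(\<integral>\<^sup>+x. ennreal \<bar>f x\<bar> \<partial>lebesgue) \<le> (\<integral>\<^sup>+x. ennreal M * indicator {a..b} x \<partial>lebesgue)"
  proof (rule nn_integral_mono)
    fix x show "ennreal \<bar>f x\<bar> \<le> ennreal M * indicator {a..b} x"
      using f[of x] by (cases "x \<in> {a..b}") (auto intro: ennreal_leI)
  qed
  also have "\<dots> < \<infinity>"
    by (subst nn_integral_cmult_indicator) (auto simp: ennreal_mult_less_top emeasure_lborel_Icc_eq)
  finally obtain Q where Q: "0 \<le> Q" "(\<integral>\<^sup>+x. ennreal \<bar>f x\<bar> \<partial>lebesgue) = ennreal Q"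
    by (cases "\<integral>\<^sup>+x. ennreal \<bar>f x\<bar> \<partial>lebesgue") auto
  have "cesaro_integral p I f \<le> ennreal (Q powr p) * tail a"
    using assms(1) Q supp by (intro cesaro_integral_le_tail) auto
  also have "\<dots> < \<infinity>"
    using tail_finite[OF assms(1)] by (simp add: ennreal_mult_less_top)
  finally show ?thesis .
qed

subsection \<open>The copy of \<open>L\<^sup>1\<close> carried by an interior interval\<close>

text \<open>The distance from 0 bounds the Cesaro norm by a multiple of the L1 norm, through
  \<open>tail (1/4)\<close>. The room between 1/2 and 1, which both choices of \<open>I\<close>
  contain, gives the reverse estimate, because every average taken there sees all the mass on
  \<open>W\<close>. The interval is half-open so that it splits into cells of the same
  shape.\<close>

definition W :: "real set" where "W = {1/4<..1/2}"

lemma W_measurable [measurable]: "W \<in> sets lebesgue"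
  by (simp add: W_def)

lemma W_subset: "W \<subseteq> I"
  using unit_interval_subset by (auto simp: W_def)

lemma emeasure_W: "emeasure lebesgue W = ennreal (1/4)"
  by (simp add: W_def)

lemma window_in_Ces:
  assumes [measurable]: "f \<in> borel_measurable lebesgue"
    and supp: "\<And>x. x \<notin> W \<Longrightarrow> f x = 0"
    and bound: "(\<integral>\<^sup>+x. ennreal \<bar>f x\<bar> \<partial>lebesgue) \<le> ennreal Q" and Q: "0 \<le> Q"
  shows "abs_lfun f \<in> Ces p I"
    and "ces_norm p I (abs_lfun f) \<le> enn2real (tail (1/4)) powr (1/p) * Q"
proof -
  let ?d = "enn2real (tail (1/4))"
  have d: "tail (1/4) = ennreal ?d" using tail_finite[of "1/4"] by simp
  have le: "cesaro_integral p I f \<le> ennreal (Q powr p * ?d)"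
    using cesaro_integral_le_tail[of "1/4" Q f] supp bound Q
    by (simp add: d[symmetric] ennreal_mult W_def)
  show "abs_lfun f \<in> Ces p I"
    using le W_subset supp by (auto simp: abs_lfun_in_Ces_iff intro: le_less_trans)
  have "ces_norm p I (abs_lfun f) \<le> (Q powr p * ?d) powr (1/p)"
    using le p_pos by (auto simp: ces_norm_def ces_integral_abs enn2real_leI intro!: powr_mono2)
  also have "\<dots> = ?d powr (1/p) * Q"
    using p_pos Q by (simp add: powr_mult powr_powr)
  finally show "ces_norm p I (abs_lfun f) \<le> ?d powr (1/p) * Q" .
qed

text \<open>For \<open>x\<close> in \<open>{1/2..1}\<close> the primitive of \<open>f\<close> is at
  least the mass on \<open>W\<close>, and division by \<open>x \<le> 1\<close> does not decrease it.
  Integration over this interval of length 1/2 costs the factor \<open>2 powr (1/p)\<close>, which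
  is at most 2 because \<open>p \<ge> 1\<close>.\<close>

lemma mass_W_le:
  assumes "F \<in> Ces p I" shows "mass W F \<le> ennreal (2 * ces_norm p I F)"
proof -
  obtain f where [measurable]: "f \<in> borel_measurable lebesgue" and eq: "F = abs_lfun f"
    by (rule lfun_eq_abs)
  have fin: "cesaro_integral p I f < \<infinity>"
    using assms by (simp add: eq abs_lfun_in_Ces_iff)
  then obtain c where c: "0 \<le> c" "cesaro_integral p I f = ennreal c"
    by (cases "cesaro_integral p I f") auto
  have "ennpowr (mass W F) p * ennreal (1/2) = (\<integral>\<^sup>+x. ennpowr (mass W F) p * indicator {1/2..1::real} x \<partial>lebesgue)"
    by (subst nn_integral_cmult_indicator) auto
  also have "\<dots> \<le> cesaro_integral p I f"
    unfolding cesaro_integral_eq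
  proof (intro nn_integral_mono)
    fix x :: real
    show "ennpowr (mass W F) p * indicator {1/2..1} x \<le> ennpowr (primitive f x / ennreal x) p * indicator I x"
    proof (cases "x \<in> {1/2..1}")
      case True
      have "mass W F \<le> primitive f x"
        unfolding eq primitive_def using True
        by (auto simp: mass_abs W_def intro!: nn_integral_mono split: split_indicator)
      also have "\<dots> \<le> primitive f x / ennreal x"
      proof -
        have "1 \<le> ennreal (inverse x)"
          using True by (simp add: one_le_inverse)
        then have "primitive f x * 1 \<le> primitive f x * ennreal (inverse x)"
          by (rule mult_left_mono) simp
        then show ?thesis using True by (simp add: divide_ennreal_def inverse_ennreal)
      qed
      finally show ?thesis using True unit_interval_subset p_pos
        by (auto intro!: ennpowr_mono simp: subset_eq split: split_indicator)
    qed simp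
  qed
  finally have le: "ennpowr (mass W F) p * ennreal (1/2) \<le> ennreal c" by (simp add: c)
  then have "mass W F \<noteq> top" 
    by (auto simp: ennpowr_def ennreal_top_mult top_unique)
  then obtain q where q: "0 \<le> q" "mass W F = ennreal q" by (cases "mass W F") auto
  then have "ennreal (q powr p * (1/2)) \<le> ennreal c"
    by (subst ennreal_mult) (use le in \<open>auto simp: ennpowr_def\<close>)
  with c have "q powr p * (1/2) \<le> c" by simp
  then have "(q powr p) powr (1/p) \<le> (2 * c) powr (1/p)"
    using p_pos by (intro powr_mono2) auto
  then have "q \<le> 2 powr (1/p) * c powr (1/p)"
    using q p_pos c by (simp add: powr_powr powr_mult)
  also have "\<dots> \<le> 2 powr 1 * c powr (1/p)"
    using p_ge_1 by (intro mult_right_mono powr_mono) auto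
  finally have "q \<le> 2 * ces_norm p I F"
    using c by (simp add: eq ces_norm_def ces_integral_abs)
  then show ?thesis
    unfolding q(2) by (rule ennreal_leI)
qed

subsection \<open>Separability\<close>

definition box :: "nat \<Rightarrow> real set" where
  "box m = {1 / real (Suc m)..real (Suc m)} \<inter> I"

lemma box_measurable [measurable]: "box m \<in> sets lebesgue"
  unfolding box_def by (rule sets.Int) auto

text \<open>A step function on the grid of width \<open>1 / n\<close>, cut off to a box. Reading the
  values from a list of rationals, continued by 0, makes every triple \<open>(m, n, qs)\<close>
  admissible, so the family is countable by its type.\<close>

definition step :: "nat \<Rightarrow> nat \<Rightarrow> rat list \<Rightarrow> real \<Rightarrow> real" where
  "step m n qs x = of_rat (nth_default 0 qs (nat \<lfloor>real n * x\<rfloor>)) * indicator (box m) x"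

lemma step_measurable [measurable]: "step m n qs \<in> borel_measurable lebesgue"
proof -
  have [measurable]: "(\<lambda>x::real. of_rat (nth_default 0 qs (nat \<lfloor>real n * x\<rfloor>)) :: real) \<in> borel_measurable lebesgue"
    by (rule measurable_completion) measurable
  show ?thesis unfolding step_def[abs_def] by measurable
qed

lemma cesaro_integral_box:
  assumes "\<And>x. \<bar>f x\<bar> \<le> M * indicator (box m) x"
  shows "cesaro_integral p I f < \<infinity>"
proof (rule cesaro_integral_bounded_support)
  show "\<bar>f x\<bar> \<le> \<bar>M\<bar> * indicator {1 / real (Suc m)..real (Suc m)} x" for x
    using assms[of x] by (auto simp: box_def split: split_indicator_asm split_indicator)
qed simp

text \<open>Closeness is measured by the p-th power of the norm, which avoids roots until the very
  end.\<close>

definition approximable :: "(real \<Rightarrow> real) \<Rightarrow> bool" where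
  "approximable f \<longleftrightarrow>
     (\<forall>e>0. \<exists>m n qs. cesaro_integral p I (\<lambda>x. f x - step m n qs x) < ennreal e)"

lemma approximable_step: "approximable (step m n qs)"
  unfolding approximable_def by (intro allI impI exI[of _ m] exI[of _ n] exI[of _ qs])
    (simp add: cesaro_integral_zero)

text \<open>The engine of the separability proof: approximability survives dominated limits almost
  everywhere. It is used to pass from steps to continuous functions on a box, then to bounded
  measurable ones, then to the whole space.\<close>

lemma approximable_limit:
  assumes [measurable]: "f \<in> borel_measurable lebesgue" "h \<in> borel_measurable lebesgue"
      "\<And>n. u n \<in> borel_measurable lebesgue"
    and u: "\<And>n::nat. approximable (u n)" and fin: "cesaro_integral p I h < \<infinity>"
    and bound: "\<And>n. AE x in lebesgue. \<bar>f x - u n x\<bar> \<le> \<bar>h x\<bar>"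
    and lim: "AE x in lebesgue. (\<lambda>n. u n x) \<longlonglongrightarrow> f x"
  shows "approximable f"
  unfolding approximable_def
proof (intro allI impI)
  fix e :: real assume "0 < e"
  \<comment> \<open>Two errors of size \<open>e'\<close> add up to \<open>e\<close> after the factor
    \<open>2 powr p\<close> of the quasi-triangle inequality.\<close>
  define e' where "e' = e / (2 * 2 powr p)"
  have e': "0 < e'" "e = 2 powr p * (e' + e')" using \<open>0 < e\<close> by (auto simp: e'_def)
  have "(\<lambda>n. cesaro_integral p I (\<lambda>x. f x - u n x)) \<longlonglongrightarrow> 0"
  proof (rule cesaro_integral_dominated[where h = h])
    show "AE x in lebesgue. (\<lambda>n. f x - u n x) \<longlonglongrightarrow> 0"
      using lim by eventually_elim (auto intro: tendsto_eq_intros)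
  qed (use p_pos fin bound in auto)
  then have "eventually (\<lambda>n. cesaro_integral p I (\<lambda>x. f x - u n x) < ennreal e') sequentially"
    using e' by (intro order_tendstoD) auto
  then obtain n where n: "cesaro_integral p I (\<lambda>x. f x - u n x) < ennreal e'"
    by (auto simp: eventually_sequentially)
  obtain m k qs where d: "cesaro_integral p I (\<lambda>x. u n x - step m k qs x) < ennreal e'"
    using u[of n] e' unfolding approximable_def by blast
  have "cesaro_integral p I (\<lambda>x. f x - step m k qs x)
     \<le> ennreal (2 powr p) * (cesaro_integral p I (\<lambda>x. f x - u n x) + cesaro_integral p I (\<lambda>x. u n x - step m k qs x))"
    using cesaro_integral_add_le[of p I "\<lambda>x. f x - u n x" "\<lambda>x. u n x - step m k qs x"] p_pos by simp
  also have "\<dots> < ennreal (2 powr p) * (ennreal e' + ennreal e')"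
    using n d by (intro ennreal_mult_strict_left_mono add_strict_mono) auto
  also have "\<dots> = ennreal e"
    using e' by (simp flip: ennreal_mult ennreal_plus)
  finally show "\<exists>m n qs. cesaro_integral p I (\<lambda>x. f x - step m n qs x) < ennreal e"
    by blast
qed

lemma approximable_continuous:
  assumes g: "continuous_on UNIV g" and M: "\<And>x. \<bar>g x\<bar> \<le> M"
  shows "approximable (\<lambda>x. g x * indicator (box m) x)"
proof -
  have "\<exists>q. \<bar>of_rat q - g (real i / real (Suc n))\<bar> < 1 / real (Suc n)" for i n
  proof -
    obtain q where "g (real i / real (Suc n)) < real_of_rat q"
      "real_of_rat q < g (real i / real (Suc n)) + 1 / real (Suc n)"
      using of_rat_dense[of "g (real i / real (Suc n))" "g (real i / real (Suc n)) + 1 / real (Suc n)"] by auto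
    then show ?thesis by (intro exI[of _ q]) auto
  qed
  then obtain q where q: "\<And>i n. \<bar>of_rat (q i n) - g (real i / real (Suc n))\<bar> < 1 / real (Suc n)"
    by metis
  \<comment> \<open>On \<open>box m\<close> one has \<open>x \<le> Suc m\<close>, so the cell index
    is at most \<open>Suc n * Suc m\<close>. The list has one entry for each index up to and
    including this one, and the default 0 is never read inside the box.\<close>
  define u where "u n = step m (Suc n) (map (\<lambda>i. q i n) [0..<Suc (Suc n * Suc m)])" for n
  define idx where "idx n x = nat \<lfloor>real (Suc n) * x\<rfloor>" for n and x :: real
  have u: "u n x = of_rat (q (idx n x) n)" if "x \<in> box m" for n x
  proof -
    have x: "0 \<le> x" "x \<le> real (Suc m)" using that I_nonneg by (auto simp: box_def)
    have "real (Suc n) * x \<le> real (Suc n * Suc m)"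
      using mult_left_mono[OF x(2), of "real (Suc n)"] by (simp del: of_nat_Suc mult_Suc mult_Suc_right)
    then have "idx n x < Suc (Suc n * Suc m)"
      unfolding idx_def by linarith
    then show ?thesis
      using that by (simp add: u_def step_def nth_default_def idx_def del: upt_Suc mult_Suc mult_Suc_right of_nat_Suc)
  qed
  have idx: "(\<lambda>n. real (idx n x) / real (Suc n)) \<longlonglongrightarrow> x" if "0 \<le> x" for x
  proof (rule real_tendsto_sandwich)
    have fl: "x * real (Suc n) - 1 \<le> real (idx n x)" "real (idx n x) \<le> x * real (Suc n)" for n
      using that unfolding idx_def by (auto simp: mult.commute[of x])
    show "\<forall>\<^sub>F n in sequentially. x - inverse (real (Suc n)) \<le> real (idx n x) / real (Suc n)"
    proof (intro always_eventually allI)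
      fix n
      have "(x * real (Suc n) - 1) / real (Suc n) \<le> real (idx n x) / real (Suc n)"
        by (intro divide_right_mono fl) simp
      then show "x - inverse (real (Suc n)) \<le> real (idx n x) / real (Suc n)"
        by (simp add: diff_divide_distrib inverse_eq_divide del: of_nat_Suc)
    qed
    show "\<forall>\<^sub>F n in sequentially. real (idx n x) / real (Suc n) \<le> x"
      using fl(2) by (intro always_eventually allI) (simp add: field_simps del: of_nat_Suc)
    show "(\<lambda>n. x - inverse (real (Suc n))) \<longlonglongrightarrow> x"
      using tendsto_diff[OF tendsto_const[of x] LIMSEQ_inverse_real_of_nat] by simp
  qed simp
  have [measurable]: "g \<in> borel_measurable lebesgue"
    using g by (intro measurable_completion borel_measurable_continuous_onI)
      (auto simp: measurable_lborel2 intro: borel_measurable_continuous_onI)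
  show ?thesis
  \<comment> \<open>The bound \<open>2 * M + 1\<close> allows \<open>M\<close> for
    \<open>g x\<close>, \<open>M\<close> for the value of \<open>g\<close> at the grid point, and 1
    for the rational rounding.\<close>
  proof (rule approximable_limit[where u = u and h = "\<lambda>x. (2 * M + 1) * indicator (box m) x"])
    show "approximable (u n)" for n by (simp add: u_def approximable_step)
    show "u n \<in> borel_measurable lebesgue" for n by (simp add: u_def)
    show "cesaro_integral p I (\<lambda>x. (2 * M + 1) * indicator (box m) x) < \<infinity>"
      using M[of 0] by (intro cesaro_integral_box[where M = "2 * M + 1"]) (auto simp: abs_mult)
    show "AE x in lebesgue. \<bar>g x * indicator (box m) x - u n x\<bar> \<le> \<bar>(2 * M + 1) * indicator (box m) x\<bar>" for n
    proof (rule AE_I2)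
      fix x
      show "\<bar>g x * indicator (box m) x - u n x\<bar> \<le> \<bar>(2 * M + 1) * indicator (box m) x\<bar>"
      proof (cases "x \<in> box m")
        case True
        have "1 / real (Suc n) \<le> 1" by simp
        then have "\<bar>g x - u n x\<bar> \<le> 2 * M + 1"
          using q[of "idx n x" n] M[of x] M[of "real (idx n x) / real (Suc n)"] u[OF True, of n]
          by linarith
        then show ?thesis using True by simp
      qed (simp add: u_def step_def)
    qed
    show "AE x in lebesgue. (\<lambda>n. u n x) \<longlonglongrightarrow> g x * indicator (box m) x"
    proof (rule AE_I2)
      fix x
      show "(\<lambda>n. u n x) \<longlonglongrightarrow> g x * indicator (box m) x"
      proof (cases "x \<in> box m")
        case True
        then have "0 \<le> x" using I_nonneg by (auto simp: box_def)
        have "(\<lambda>n. g (real (idx n x) / real (Suc n))) \<longlonglongrightarrow> g x"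
          using g by (intro isCont_tendsto_compose[OF _ idx[OF \<open>0 \<le> x\<close>]]) (simp add: continuous_on_eq_continuous_at)
        moreover have "(\<lambda>n. of_rat (q (idx n x) n) - g (real (idx n x) / real (Suc n))) \<longlonglongrightarrow> 0"
          by (rule Lim_null_comparison[OF _ LIMSEQ_inverse_real_of_nat])
            (use q in \<open>auto simp: inverse_eq_divide less_imp_le simp del: of_nat_Suc\<close>)
        ultimately have "(\<lambda>n. of_rat (q (idx n x) n)) \<longlonglongrightarrow> g x"
          using tendsto_add by fastforce
        then show ?thesis using True by (simp add: u)
      qed (simp add: u_def step_def)
    qed
  qed measurable
qed

text \<open>A measurable function is the limit almost everywhere of continuous functions. Clamping
  these to the range from \<open>- M\<close> to \<open>M\<close> keeps them continuous, leaves the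
  limit unchanged since \<open>f\<close> stays in that range, and supplies the domination.\<close>

lemma approximable_bounded:
  assumes [measurable]: "f \<in> borel_measurable lebesgue" and M: "\<And>x. \<bar>f x\<bar> \<le> M"
  shows "approximable (\<lambda>x. f x * indicator (box m) x)"
proof -
  have "f measurable_on UNIV"
    by (rule lebesgue_measurable_imp_measurable_on) auto
  then obtain Z g where Z: "negligible Z" and g: "\<And>n. continuous_on UNIV (g n)"
    and lim: "\<And>x. x \<notin> Z \<Longrightarrow> (\<lambda>n::nat. g n x) \<longlonglongrightarrow> f x"
    by (auto simp: measurable_on_def)
  define c where "c n x = max (- M) (min M (g n x))" for n x
  have M0: "0 \<le> M" using M[of 0] by simp
  have c_cont: "continuous_on UNIV (c n)" for n
    unfolding c_def by (intro continuous_intros g)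
  have c_bound: "\<bar>c n x\<bar> \<le> M" for n x
    using M0 by (auto simp: c_def)
  have [measurable]: "c n \<in> borel_measurable lebesgue" for n
    using c_cont by (intro measurable_completion) (auto simp: measurable_lborel2 intro: borel_measurable_continuous_onI)
  have Z_null: "AE x in lebesgue. x \<notin> Z"
    using Z by (intro AE_not_in) (simp add: negligible_iff_null_sets)
  show ?thesis
  proof (rule approximable_limit[where u = "\<lambda>n x. c n x * indicator (box m) x"
        and h = "\<lambda>x. (2 * M) * indicator (box m) x"])
    show "approximable (\<lambda>x. c n x * indicator (box m) x)" for n
      by (rule approximable_continuous[OF c_cont c_bound])
    show "cesaro_integral p I (\<lambda>x. (2 * M) * indicator (box m) x) < \<infinity>"
      using M0 by (intro cesaro_integral_box[where M = "2 * M"]) (auto simp: abs_mult)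
    show "AE x in lebesgue. \<bar>f x * indicator (box m) x - c n x * indicator (box m) x\<bar>
        \<le> \<bar>(2 * M) * indicator (box m) x\<bar>" for n
    proof (rule AE_I2)
      fix x show "\<bar>f x * indicator (box m) x - c n x * indicator (box m) x\<bar> \<le> \<bar>(2 * M) * indicator (box m) x\<bar>"
        using M[of x] c_bound[of n x] M0 by (auto split: split_indicator)
    qed
    show "AE x in lebesgue. (\<lambda>n. c n x * indicator (box m) x) \<longlonglongrightarrow> f x * indicator (box m) x"
      using Z_null
    proof eventually_elim
      case (elim x)
      have "(\<lambda>n. c n x) \<longlonglongrightarrow> max (- M) (min M (f x))"
        unfolding c_def by (intro tendsto_intros lim elim)
      moreover have "max (- M) (min M (f x)) = f x" using M[of x] by auto
      ultimately show ?case by (intro tendsto_intros) auto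
    qed
  qed measurable
qed

text \<open>Truncation in height and to a box changes \<open>f\<close> by at most its own absolute
  value, so \<open>f\<close> dominates the errors. The boxes exhaust \<open>I\<close> except for the
  null set consisting of 0.\<close>

lemma approximable:
  assumes [measurable]: "f \<in> borel_measurable lebesgue"
    and off: "AE x in lebesgue. x \<notin> I \<longrightarrow> f x = 0" and fin: "cesaro_integral p I f < \<infinity>"
  shows "approximable f"
proof (rule approximable_limit[where h = f
      and u = "\<lambda>m x. (if \<bar>f x\<bar> \<le> real m then f x else 0) * indicator (box m) x"])
  show "approximable (\<lambda>x. (if \<bar>f x\<bar> \<le> real m then f x else 0) * indicator (box m) x)" for m
    by (rule approximable_bounded[where M = "real m"]) auto
  show "AE x in lebesgue. \<bar>f x - (if \<bar>f x\<bar> \<le> real m then f x else 0) * indicator (box m) x\<bar> \<le> \<bar>f x\<bar>" for m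
    by (intro AE_I2) (auto split: split_indicator)
  have "AE x in lebesgue. x \<noteq> 0" by (rule AE_completion) (rule AE_lborel_singleton)
  with off show "AE x in lebesgue.
      (\<lambda>m. (if \<bar>f x\<bar> \<le> real m then f x else 0) * indicator (box m) x) \<longlonglongrightarrow> f x"
  proof eventually_elim
    case (elim x)
    show ?case
    proof (cases "x \<in> I")
      case True
      then have x: "0 < x" using elim I_nonneg[of x] by auto
      obtain k where k: "max (max \<bar>f x\<bar> x) (1 / x) \<le> real k"
        using real_arch_simple by blast
      have "(if \<bar>f x\<bar> \<le> real m then f x else 0) * indicator (box m) x = f x" if "k \<le> m" for m
      proof -
        have "max (max \<bar>f x\<bar> x) (1 / x) \<le> real m" using k that by linarith
        moreover from this have "1 / real (Suc m) \<le> x" using x by (simp add: field_simps)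
        ultimately show ?thesis using True by (auto simp: box_def)
      qed
      then show ?thesis
        by (intro tendsto_eventually eventually_sequentiallyI[of k]) auto
    qed (use elim in auto)
  qed
qed (use fin in auto)

lemma separable:
  obtains D where "countable D" "D \<subseteq> Ces p I"
    "\<And>F e. F \<in> Ces p I \<Longrightarrow> 0 < e \<Longrightarrow> \<exists>d\<in>D. ces_norm p I (F - d) < e"
proof
  let ?D = "range (\<lambda>(m, n, qs). abs_lfun (step m n qs))"
  show "countable ?D" by simp
  show "?D \<subseteq> Ces p I"
  proof clarify
    fix m n and qs :: "rat list"
    have "finite (nth_default 0 qs ` UNIV)"
      by (rule finite_subset[of _ "insert 0 (set qs)"]) (auto simp: nth_default_def)
    then obtain M where M: "\<And>i. \<bar>real_of_rat (nth_default 0 qs i)\<bar> \<le> M"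
      using finite_imageI[of _ "\<lambda>q. \<bar>real_of_rat q\<bar>"] Max_ge
      by (metis (no_types, lifting) image_eqI rangeI)
    have "cesaro_integral p I (step m n qs) < \<infinity>"
      by (rule cesaro_integral_box[where M = M]) (use M in \<open>auto simp: step_def split: split_indicator\<close>)
    then show "abs_lfun (step m n qs) \<in> Ces p I"
      by (auto simp: abs_lfun_in_Ces_iff step_def box_def)
  qed
  fix F and e :: real assume F: "F \<in> Ces p I" and e: "0 < e"
  obtain f where [measurable]: "f \<in> borel_measurable lebesgue" and eq: "F = abs_lfun f"
    by (rule lfun_eq_abs)
  have "approximable f"
    using F by (intro approximable) (auto simp: eq abs_lfun_in_Ces_iff)
  \<comment> \<open>The tolerance \<open>e powr p\<close> becomes \<open>e\<close> when the p-th
    root in the norm is taken.\<close>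
  then obtain m n qs where d: "cesaro_integral p I (\<lambda>x. f x - step m n qs x) < ennreal (e powr p)"
    using e unfolding approximable_def by fastforce
  then have "enn2real (cesaro_integral p I (\<lambda>x. f x - step m n qs x)) < e powr p"
    by (cases "cesaro_integral p I (\<lambda>x. f x - step m n qs x)") (auto simp: ennreal_less_iff)
  then have "ces_norm p I (F - abs_lfun (step m n qs)) < (e powr p) powr (1/p)"
    using p_pos by (auto simp: ces_norm_def eq abs_lfun_diff ces_integral_abs intro!: powr_less_mono2)
  then show "\<exists>d\<in>?D. ces_norm p I (F - d) < e"
    using p_pos e by (auto simp: powr_powr)
qed

end

section \<open>Failure of the Radon-Nikodym property\<close>

lemma numeral_mult_ennreal: "0 \<le> a \<Longrightarrow> numeral k * ennreal a = ennreal (numeral k * a)"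
  by (subst ennreal_mult) auto

lemma mass_simple_measurable:
  "simple_function M s \<Longrightarrow> (\<lambda>w. mass J (s w)) \<in> borel_measurable M"
  by (rule borel_measurable_simple_function) (rule simple_function_compose1[where g = "mass J"])

text \<open>The triangle inequality for the finite sum over the values of \<open>s\<close>, combined
  with homogeneity.\<close>

lemma mass_simple_bochner_integral_le:
  assumes "finite_measure M" and s: "simple_function M s" and J: "J \<in> sets lebesgue"
  shows "mass J (Bochner_Integration.simple_bochner_integral M s) \<le> (\<integral>\<^sup>+w. mass J (s w) \<partial>M)"
proof -
  interpret finite_measure M by fact
  let ?A = "\<lambda>y. {w \<in> space M. s w = y}"
  have fin: "finite (s ` space M)"
    using s by (simp add: simple_function_def)
  have [measurable]: "?A y \<in> sets M" for y
  proof -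
    have "?A y = s -` {y} \<inter> space M" by auto
    then show ?thesis using simple_functionD(2)[OF s] by simp
  qed
  have "mass J (Bochner_Integration.simple_bochner_integral M s) \<le> (\<Sum>y\<in>s ` space M. mass J (measure M (?A y) *\<^sub>R y))"
    unfolding simple_bochner_integral_def by (rule mass_sum_le[OF J])
  also have "\<dots> = (\<Sum>y\<in>s ` space M. \<integral>\<^sup>+w. mass J y * indicator (?A y) w \<partial>M)"
    using J by (intro sum.cong refl) 
      (simp add: mass_scaleR nn_integral_cmult_indicator emeasure_eq_measure mult.commute)
  also have "\<dots> = (\<integral>\<^sup>+w. (\<Sum>y\<in>s ` space M. mass J y * indicator (?A y) w) \<partial>M)"
    by (rule nn_integral_sum[symmetric]) auto
  also have "\<dots> = (\<integral>\<^sup>+w. mass J (s w) \<partial>M)"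
  proof (rule nn_integral_cong)
    fix w assume w: "w \<in> space M"
    have "(\<Sum>y\<in>s ` space M. mass J y * indicator (?A y) w) = (\<Sum>y\<in>{s w}. mass J y * indicator (?A y) w)"
      using w fin by (intro sum.mono_neutral_right) auto
    then show "(\<Sum>y\<in>s ` space M. mass J y * indicator (?A y) w) = mass J (s w)"
      using w by simp
  qed
  finally show ?thesis .
qed

context cesaro_space
begin

lemma mass_W_finite: "F \<in> Ces p I \<Longrightarrow> mass W F \<noteq> top"
  using le_less_trans[OF mass_W_le ennreal_less_top] by (simp add: less_top)

text \<open>\<open>ces_norm p I (g w - s w)\<close> is not known to be measurable in \<open>w\<close> and \<open>nn_integral\<close> is
  a lower integral, whence the detour through the measurable function \<open>u\<close>.\<close>

lemma strongly_measurable_mass: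
  assumes g: "strongly_measurable (Ces p I) (ces_norm p I) M g"
    and s: "simple_function M s" "s \<in> space M \<rightarrow> Ces p I"
  obtains u where "u \<in> borel_measurable M" "AE w in M. mass W (g w - s w) = u w"
    "(\<integral>\<^sup>+w. u w \<partial>M) \<le> 2 * (\<integral>\<^sup>+w. ennreal (ces_norm p I (g w - s w)) \<partial>M)"
proof -
  obtain t where t: "\<And>i::nat. simple_function M (t i)" "\<And>i. t i \<in> space M \<rightarrow> Ces p I"
    and lim: "AE w in M. (\<lambda>i. ces_norm p I (g w - t i w)) \<longlonglongrightarrow> 0"
    using g unfolding strongly_measurable_def by blast
  have gV: "g \<in> space M \<rightarrow> Ces p I"
    using g by (simp add: strongly_measurable_def)
  \<comment> \<open>The functions \<open>t i - s\<close> are simple, so their masses are measurable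
    and so is the upper limit. Convergence in norm turns it, almost everywhere, into the limit
    \<open>mass W (g w - s w)\<close>.\<close>
  define u where "u w = limsup (\<lambda>i. mass W (t i w - s w))" for w
  have [measurable]: "(\<lambda>w. mass W (t i w - s w)) \<in> borel_measurable M" for i
    by (intro mass_simple_measurable simple_function_diff t s)
  have u [measurable]: "u \<in> borel_measurable M"
    unfolding u_def by measurable
  have eq: "AE w in M. mass W (g w - s w) = u w"
    using lim AE_space
  proof eventually_elim
    case (elim w)
    then have V: "g w - s w \<in> Ces p I" "t i w - s w \<in> Ces p I" "g w - t i w \<in> Ces p I" for i
      using gV t(2) s(2) by (auto intro!: subspace_diff[OF subspace_Ces])
    define e where "e i = ennreal (2 * ces_norm p I (g w - t i w))" for i
    have e: "mass W (g w - t i w) \<le> e i" for i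
      unfolding e_def by (rule mass_W_le[OF V(3)])
    have "(\<lambda>i. 2 * ces_norm p I (g w - t i w)) \<longlonglongrightarrow> 2 * 0"
      by (intro tendsto_mult tendsto_const elim)
    then have e0: "e \<longlonglongrightarrow> 0" unfolding e_def using tendsto_ennrealI by fastforce
    have "(\<lambda>i. mass W (t i w - s w)) \<longlonglongrightarrow> mass W (g w - s w)"
    proof (rule tendsto_sandwich)
      have "mass W (g w - s w) \<le> e i + mass W (t i w - s w)" for i
        by (rule order_trans[OF mass_triangle[OF W_measurable] add_right_mono[OF e]])
      then show "\<forall>\<^sub>F i in sequentially. mass W (g w - s w) - e i \<le> mass W (t i w - s w)"
        by (intro always_eventually allI) (simp add: e_def ennreal_minus_le_iff)
      have "mass W (t i w - s w) \<le> e i + mass W (g w - s w)" for i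
        by (rule order_trans[OF mass_triangle[OF W_measurable] add_right_mono])
          (metis e mass_diff_commute[OF W_measurable])
      then show "\<forall>\<^sub>F i in sequentially. mass W (t i w - s w) \<le> e i + mass W (g w - s w)"
        by (intro always_eventually allI)
      show "(\<lambda>i. mass W (g w - s w) - e i) \<longlonglongrightarrow> mass W (g w - s w)"
        using tendsto_diff_ennreal[OF tendsto_const[of "mass W (g w - s w)"] e0] mass_W_finite[OF V(1)]
        by simp
      show "(\<lambda>i. e i + mass W (g w - s w)) \<longlonglongrightarrow> mass W (g w - s w)"
        using tendsto_add[OF e0 tendsto_const[of "mass W (g w - s w)"]] by simp
    qed
    then show ?case
      unfolding u_def by (intro lim_imp_Limsup[symmetric]) auto
  qed
  \<comment> \<open>The factor 2 is taken out of the integral of the measurable \<open>u\<close>.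
    The comparison with the norm, whose measurability is unknown, then uses monotonicity of the
    integral alone.\<close>
  have "2 * ennreal (1/2) = 1"
    by (subst numeral_mult_ennreal) auto
  then have "(\<integral>\<^sup>+w. u w \<partial>M) = (\<integral>\<^sup>+w. 2 * (ennreal (1/2) * u w) \<partial>M)"
    by (simp only: mult.assoc[symmetric] mult_1)
  also have "\<dots> = 2 * (\<integral>\<^sup>+w. ennreal (1/2) * u w \<partial>M)"
    by (rule nn_integral_cmult) measurable
  also have "(\<integral>\<^sup>+w. ennreal (1/2) * u w \<partial>M) \<le> (\<integral>\<^sup>+w. ennreal (ces_norm p I (g w - s w)) \<partial>M)"
  proof (rule nn_integral_mono_AE)
    show "AE w in M. ennreal (1/2) * u w \<le> ennreal (ces_norm p I (g w - s w))"
      using eq AE_space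
    proof eventually_elim
      case (elim w)
      then have "g w - s w \<in> Ces p I"
        using gV s(2) by (auto intro!: subspace_diff[OF subspace_Ces])
      from mult_left_mono[OF mass_W_le[OF this], of "ennreal (1/2)"] elim(1)
      have "ennreal (1/2) * u w \<le> ennreal (1/2) * ennreal (2 * ces_norm p I (g w - s w))"
        by simp
      also have "\<dots> = ennreal (ces_norm p I (g w - s w))"
        by (subst ennreal_mult[symmetric]) (auto simp: ces_norm_nonneg)
      finally show ?case .
    qed
  qed
  finally have "(\<integral>\<^sup>+w. u w \<partial>M) \<le> 2 * (\<integral>\<^sup>+w. ennreal (ces_norm p I (g w - s w)) \<partial>M)"
    by (simp add: mult_left_mono)
  with u eq show ?thesis by (rule that)
qed

lemma simple_bochner_integral_in_Ces:
  assumes "s \<in> space M \<rightarrow> Ces p I" shows "Bochner_Integration.simple_bochner_integral M s \<in> Ces p I"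
  unfolding simple_bochner_integral_def
proof (intro subspace_sum[OF subspace_Ces] subspace_scale[OF subspace_Ces])
  fix y assume "y \<in> s ` space M"
  then show "y \<in> Ces p I" using assms by blast
qed

text \<open>Morally, the integral of \<open>g\<close> over \<open>J\<close> is split into those of
  \<open>g - s\<close> and of \<open>s\<close>. As \<open>v\<close> is only given as a limit of
  integrals of simple functions \<open>t i\<close>, the estimate is shown with errors
  \<open>?n2 i\<close> and \<open>2 * ?n1 i\<close>, which tend to 0. The first term is bounded by
  the mass on all of \<open>W\<close>, but the second one keeps the set \<open>K\<close>: it becomes
  small when \<open>K\<close> is small.\<close>

lemma mass_bochner_integral_le:
  assumes M: "finite_measure M" and J: "J \<in> sets M"
    and int: "has_bochner_integral_in (Ces p I) (ces_norm p I) M (\<lambda>w. indicator J w *\<^sub>R g w) v"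
    and s: "simple_function M s" "s \<in> space M \<rightarrow> Ces p I"
    and u: "u \<in> borel_measurable M" "AE w in M. mass W (g w - s w) = u w"
    and K: "K \<in> sets lebesgue" "K \<subseteq> W"
  shows "mass K v \<le> (\<integral>\<^sup>+w. u w * indicator J w \<partial>M) + (\<integral>\<^sup>+w. mass K (indicator J w *\<^sub>R s w) \<partial>M)"
proof -
  interpret finite_measure M by fact
  note [measurable] = J u(1)
  let ?h = "\<lambda>w. indicator J w *\<^sub>R s w"
  have h: "simple_function M ?h"
    by (intro simple_function_compose2[where h = "\<lambda>a b. a *\<^sub>R b"] s simple_function_indicator J)
  then have hb: "Bochner_Integration.simple_bochner_integrable M ?h"
    by (intro simple_bochner_integrable.intros) auto
  obtain t where t: "\<And>i::nat. Bochner_Integration.simple_bochner_integrable M (t i)" "\<And>i. t i \<in> space M \<rightarrow> Ces p I"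
    and lim1: "(\<lambda>i. \<integral>\<^sup>+w. ennreal (ces_norm p I (indicator J w *\<^sub>R g w - t i w)) \<partial>M) \<longlonglongrightarrow> 0"
    and lim2: "(\<lambda>i. ces_norm p I (Bochner_Integration.simple_bochner_integral M (t i) - v)) \<longlonglongrightarrow> 0"
    and sm: "strongly_measurable (Ces p I) (ces_norm p I) M (\<lambda>w. indicator J w *\<^sub>R g w)"
    and v: "v \<in> Ces p I"
    using int unfolding has_bochner_integral_in_def by blast
  have ts: "simple_function M (t i)" for i
    using t(1) by (auto elim: simple_bochner_integrable.cases)
  let ?n1 = "\<lambda>i. \<integral>\<^sup>+w. ennreal (ces_norm p I (indicator J w *\<^sub>R g w - t i w)) \<partial>M"
  let ?n2 = "\<lambda>i. ennreal (2 * ces_norm p I (Bochner_Integration.simple_bochner_integral M (t i) - v))"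
  let ?R = "(\<integral>\<^sup>+w. u w * indicator J w \<partial>M) + (\<integral>\<^sup>+w. mass K (?h w) \<partial>M)"
  have le: "mass K v \<le> ?n2 i + 2 * ?n1 i + ?R" for i
  proof -
    let ?S = "Bochner_Integration.simple_bochner_integral M (t i)"
    obtain q where [measurable]: "q \<in> borel_measurable M"
      and q: "AE w in M. mass W (indicator J w *\<^sub>R g w - t i w) = q w" "(\<integral>\<^sup>+w. q w \<partial>M) \<le> 2 * ?n1 i"
      by (rule strongly_measurable_mass[OF sm ts t(2)])
    have "mass K v = mass K (v - 0)" by simp
    also have "\<dots> \<le> mass K (v - ?S) + mass K (?S - 0)"
      by (rule mass_triangle[OF K(1)])
    also have "mass K (?S - 0) \<le> mass K (?S - Bochner_Integration.simple_bochner_integral M ?h) + mass K (Bochner_Integration.simple_bochner_integral M ?h - 0)"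
      by (rule mass_triangle[OF K(1)])
    also have "mass K (v - ?S) \<le> mass W (?S - v)"
      using mass_mono[OF K(2)] mass_diff_commute[OF K(1), of v ?S] by simp
    also have "mass W (?S - v) \<le> ?n2 i"
      by (intro mass_W_le subspace_diff[OF subspace_Ces] simple_bochner_integral_in_Ces t v)
    also have "mass K (Bochner_Integration.simple_bochner_integral M ?h - 0) \<le> (\<integral>\<^sup>+w. mass K (?h w) \<partial>M)"
      using mass_simple_bochner_integral_le[OF M h K(1)] by simp
    also have "mass K (?S - Bochner_Integration.simple_bochner_integral M ?h) = mass K (Bochner_Integration.simple_bochner_integral M (\<lambda>w. t i w - ?h w))"
      by (simp add: simple_bochner_integral_diff[OF t(1) hb])
    also have "\<dots> \<le> (\<integral>\<^sup>+w. mass K (t i w - ?h w) \<partial>M)"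
      by (intro mass_simple_bochner_integral_le[OF M _ K(1)] simple_function_diff ts h)
    also have "\<dots> \<le> (\<integral>\<^sup>+w. q w + u w * indicator J w \<partial>M)"
    proof (rule nn_integral_mono_AE)
      show "AE w in M. mass K (t i w - ?h w) \<le> q w + u w * indicator J w"
        using q(1) u(2)
      proof eventually_elim
        case (elim w)
        have "mass K (t i w - ?h w) \<le> mass W (t i w - ?h w)"
          by (rule mass_mono[OF K(2)])
        also have "\<dots> \<le> mass W (t i w - indicator J w *\<^sub>R g w) + mass W (indicator J w *\<^sub>R g w - ?h w)"
          by (rule mass_triangle[OF W_measurable])
        also have "mass W (t i w - indicator J w *\<^sub>R g w) = q w"
          using elim by (simp add: mass_diff_commute[OF W_measurable, of "t i w"])
        also have "mass W (indicator J w *\<^sub>R g w - ?h w) = u w * indicator J w"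
          using elim by (simp split: split_indicator)
        finally show ?case .
      qed
    qed
    also have "\<dots> = (\<integral>\<^sup>+w. q w \<partial>M) + (\<integral>\<^sup>+w. u w * indicator J w \<partial>M)"
      by (rule nn_integral_add) auto
    also have "(\<integral>\<^sup>+w. q w \<partial>M) \<le> 2 * ?n1 i" by (rule q)
    finally show ?thesis by (simp add: add.assoc add_mono)
  qed
  have "?n2 \<longlonglongrightarrow> ennreal (2 * 0)"
    by (intro tendsto_ennrealI tendsto_mult tendsto_const lim2)
  moreover have "(\<lambda>i. 2 * ?n1 i) \<longlonglongrightarrow> 2 * 0"
    by (intro ennreal_tendsto_cmult lim1) simp
  ultimately have "(\<lambda>i. ?n2 i + 2 * ?n1 i + ?R) \<longlonglongrightarrow> ennreal (2 * 0) + 2 * 0 + ?R"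
    by (intro tendsto_add tendsto_const)
  then have "(\<lambda>i. ?n2 i + 2 * ?n1 i + ?R) \<longlonglongrightarrow> ?R" by simp
  then show ?thesis
    by (rule LIMSEQ_le_const) (use le in auto)
qed

section \<open>The vector measure given by classes of indicator functions\<close>

definition indicator_class :: "real set \<Rightarrow> lfun" where
  "indicator_class E = abs_lfun (indicator E)"

lemma sets_window: "E \<in> sets (lebesgue_on W) \<longleftrightarrow> E \<in> sets lebesgue \<and> E \<subseteq> W"
  using sets_restrict_space_iff[of W lebesgue E] by auto

lemma emeasure_window: "E \<in> sets (lebesgue_on W) \<Longrightarrow> emeasure (lebesgue_on W) E = emeasure lebesgue E"
  using emeasure_restrict_space[of W lebesgue E] by (simp add: sets_window)

lemma finite_measure_window: "finite_measure (lebesgue_on W)"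
  by (rule finite_measureI) (simp add: emeasure_window sets_window emeasure_W)

lemma indicator_class_diff:
  assumes E: "E \<in> sets (lebesgue_on W)" "E' \<in> sets (lebesgue_on W)" "E \<subseteq> E'"
  shows "indicator_class E - indicator_class E' \<in> Ces p I"
    and "ces_norm p I (indicator_class E - indicator_class E')
      \<le> enn2real (tail (1/4)) powr (1/p) * measure (lebesgue_on W) (E' - E)"
proof -
  interpret finite_measure "lebesgue_on W" by (rule finite_measure_window)
  have [measurable]: "E \<in> sets lebesgue" "E' \<in> sets lebesgue" and sub: "E' \<subseteq> W"
    using E by (auto simp: sets_window)
  let ?f = "\<lambda>x. indicator E x - indicator E' x :: real"
  have eq: "indicator_class E - indicator_class E' = abs_lfun ?f"
    unfolding indicator_class_def by (rule abs_lfun_diff) auto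
  have "(\<integral>\<^sup>+x. ennreal \<bar>?f x\<bar> \<partial>lebesgue) = (\<integral>\<^sup>+x. indicator (E' - E) x \<partial>lebesgue)"
    using E(3) by (intro nn_integral_cong) (auto split: split_indicator)
  also have "\<dots> = emeasure (lebesgue_on W) (E' - E)"
    using E by (subst emeasure_window) auto
  also have "\<dots> = ennreal (measure (lebesgue_on W) (E' - E))"
    by (rule emeasure_eq_measure)
  finally have int: "(\<integral>\<^sup>+x. ennreal \<bar>?f x\<bar> \<partial>lebesgue) \<le> ennreal (measure (lebesgue_on W) (E' - E))"
    by simp
  have "?f x = 0" if "x \<notin> W" for x
    using that sub E(3) by (auto split: split_indicator)
  from window_in_Ces[OF _ this int]
  show "indicator_class E - indicator_class E' \<in> Ces p I"
    "ces_norm p I (indicator_class E - indicator_class E')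
      \<le> enn2real (tail (1/4)) powr (1/p) * measure (lebesgue_on W) (E' - E)"
    unfolding eq by auto
qed

lemma indicator_class_Ces:
  assumes E: "E \<in> sets (lebesgue_on W)"
  shows "indicator_class E \<in> Ces p I"
    and "ces_norm p I (indicator_class E)
      \<le> enn2real (tail (1/4)) powr (1/p) * measure (lebesgue_on W) E"
proof -
  have [measurable]: "E \<in> sets lebesgue" and sub: "E \<subseteq> W"
    using E by (auto simp: sets_window)
  interpret finite_measure "lebesgue_on W" by (rule finite_measure_window)
  have "(\<integral>\<^sup>+x. ennreal \<bar>indicator E x\<bar> \<partial>lebesgue) = (\<integral>\<^sup>+x. indicator E x \<partial>lebesgue)"
    by (intro nn_integral_cong) (auto split: split_indicator)
  also have "\<dots> = ennreal (measure (lebesgue_on W) E)"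
    using E by (simp add: emeasure_window flip: emeasure_eq_measure)
  finally have int: "(\<integral>\<^sup>+x. ennreal \<bar>indicator E x\<bar> \<partial>lebesgue) \<le> ennreal (measure (lebesgue_on W) E)"
    by simp
  have "indicator E x = (0::real)" if "x \<notin> W" for x
    using that sub by (auto split: split_indicator)
  from window_in_Ces[OF _ this int]
  show "indicator_class E \<in> Ces p I" "ces_norm p I (indicator_class E)
      \<le> enn2real (tail (1/4)) powr (1/p) * measure (lebesgue_on W) E"
    unfolding indicator_class_def by auto
qed

text \<open>The partial sums are the classes of the increasing unions \<open>B n\<close>. Their
  distance from the class of the full union is at most a constant times the measure of what is still
  missing.\<close>

lemma vector_measure_indicator_class:
  "vector_measure (Ces p I) (ces_norm p I) (lebesgue_on W) indicator_class"
  unfolding vector_measure_def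
proof (intro conjI allI impI)
  show "indicator_class \<in> sets (lebesgue_on W) \<rightarrow> Ces p I"
    using indicator_class_Ces by auto
next
  fix A :: "nat \<Rightarrow> real set"
  assume A: "range A \<subseteq> sets (lebesgue_on W)" and disj: "disjoint_family A"
  interpret finite_measure "lebesgue_on W" by (rule finite_measure_window)
  let ?M = "lebesgue_on W" and ?C = "enn2real (tail (1/4)) powr (1/p)"
  define B where "B n = (\<Union>i<n. A i)" for n
  have AM: "A i \<in> sets ?M" for i using A by auto
  have B: "B n \<in> sets ?M" for n unfolding B_def using AM by auto
  have UB: "(\<Union>n. B n) = (\<Union>i. A i)" unfolding B_def by blast
  have UM: "(\<Union>i. A i) \<in> sets ?M" using AM by auto
  have sum: "(\<Sum>i<n. indicator_class (A i)) = indicator_class (B n)" for n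
  proof (induction n)
    case 0
    have "indicator ({} :: real set) = (\<lambda>_. 0 :: real)" by auto
    then have "indicator_class (B 0) = 0"
      by (simp only: indicator_class_def B_def lessThan_0 UN_empty zero_lfun.abs_eq)
    then show ?case by simp
  next
    case (Suc n)
    have [measurable]: "A n \<in> sets lebesgue" "B n \<in> sets lebesgue"
      using AM B by (auto simp: sets_window)
    have "A i \<inter> A n = {}" if "i < n" for i
      using disj that by (auto simp: disjoint_family_on_def)
    then have "B n \<inter> A n = {}"
      unfolding B_def by blast
    then have "indicator (B (Suc n)) x = (indicator (B n) x + indicator (A n) x :: real)" for x
      by (auto simp: B_def lessThan_Suc split: split_indicator)
    then have "indicator (B (Suc n)) = (\<lambda>x. indicator (B n) x + indicator (A n) x :: real)"
      by blast
    then have "indicator_class (B n) + indicator_class (A n) = indicator_class (B (Suc n))"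
      by (simp add: indicator_class_def abs_lfun_add)
    then show ?case
      by (simp add: Suc)
  qed
  have "incseq B"
    unfolding incseq_def B_def by (intro allI impI UN_mono) auto
  then have "(\<lambda>n. measure ?M (B n)) \<longlonglongrightarrow> measure ?M (\<Union>i. A i)"
    unfolding UB[symmetric] using B by (intro finite_Lim_measure_incseq) auto
  then have "(\<lambda>n. ?C * (measure ?M (\<Union>i. A i) - measure ?M (B n))) \<longlonglongrightarrow> ?C * (measure ?M (\<Union>i. A i) - measure ?M (\<Union>i. A i))"
    by (intro tendsto_intros)
  then have lim: "(\<lambda>n. ?C * (measure ?M (\<Union>i. A i) - measure ?M (B n))) \<longlonglongrightarrow> 0"
    by simp
  show "(\<lambda>n. ces_norm p I ((\<Sum>i<n. indicator_class (A i)) - indicator_class (\<Union>i. A i))) \<longlonglongrightarrow> 0"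
  proof (rule tendsto_sandwich[OF _ _ tendsto_const lim])
    show "\<forall>\<^sub>F n in sequentially. ces_norm p I ((\<Sum>i<n. indicator_class (A i)) - indicator_class (\<Union>i. A i))
        \<le> ?C * (measure ?M (\<Union>i. A i) - measure ?M (B n))"
    proof (intro always_eventually allI)
      fix n
      have sub: "B n \<subseteq> (\<Union>i. A i)" by (auto simp: B_def)
      show "ces_norm p I ((\<Sum>i<n. indicator_class (A i)) - indicator_class (\<Union>i. A i))
        \<le> ?C * (measure ?M (\<Union>i. A i) - measure ?M (B n))"
        using indicator_class_diff(2)[OF B UM sub] finite_measure_Diff[OF UM B sub]
        by (simp add: sum)
    qed
  qed (auto simp: ces_norm_nonneg)
qed

lemma continuous_wrt_indicator_class:
  "continuous_wrt (ces_norm p I) (lebesgue_on W) indicator_class"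
  unfolding continuous_wrt_def
proof (intro allI impI)
  fix e :: real assume e: "0 < e"
  let ?C = "enn2real (tail (1/4)) powr (1/p)"
  have C: "0 \<le> ?C" by simp
  show "\<exists>\<delta>>0. \<forall>E\<in>sets (lebesgue_on W). measure (lebesgue_on W) E < \<delta> \<longrightarrow> ces_norm p I (indicator_class E) < e"
  proof (intro exI[of _ "e / (?C + 1)"] conjI ballI impI)
    show "0 < e / (?C + 1)" using e C by (intro divide_pos_pos) linarith+
  next
    fix E assume E: "E \<in> sets (lebesgue_on W)" and small: "measure (lebesgue_on W) E < e / (?C + 1)"
    have "ces_norm p I (indicator_class E) \<le> ?C * measure (lebesgue_on W) E"
      by (rule indicator_class_Ces(2)[OF E])
    also have "\<dots> \<le> (?C + 1) * measure (lebesgue_on W) E"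
      by (intro mult_right_mono) auto
    also have "\<dots> < e"
      using small C by (simp add: pos_less_divide_eq mult.commute)
    finally show "ces_norm p I (indicator_class E) < e" .
  qed
qed

lemma bounded_variation_indicator_class:
  "bounded_variation (ces_norm p I) (lebesgue_on W) indicator_class"
  unfolding bounded_variation_def
proof (intro exI allI impI)
  fix P assume P: "finite P" "P \<subseteq> sets (lebesgue_on W)" "partition_on (space (lebesgue_on W)) P"
  interpret finite_measure "lebesgue_on W" by (rule finite_measure_window)
  let ?M = "lebesgue_on W" and ?C = "enn2real (tail (1/4)) powr (1/p)"
  have "disjoint_family_on (\<lambda>E. E) P" "\<Union>P = space ?M"
    using P(3) by (auto simp: partition_on_def disjoint_def disjoint_family_on_def)
  then have "(\<Sum>E\<in>P. measure ?M E) = measure ?M (space ?M)"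
    using finite_measure_finite_Union[of P "\<lambda>E. E"] P by auto
  moreover have "(\<Sum>E\<in>P. ces_norm p I (indicator_class E)) \<le> (\<Sum>E\<in>P. ?C * measure ?M E)"
    using P(2) by (intro sum_mono indicator_class_Ces) auto
  ultimately show "(\<Sum>E\<in>P. ces_norm p I (indicator_class E)) \<le> ?C * measure ?M (space ?M)"
    by (simp add: sum_distrib_left[symmetric])
qed

text \<open>\<open>E\<close> is covered by countably many pieces, each the part of a sublevel set of
  \<open>h\<close> in a short cell, so some piece has positive measure. The cell length is half the
  reciprocal of the height bound, which makes height times measure at most 1/2.\<close>

lemma exists_small_set:
  fixes h :: "real \<Rightarrow> real"
  assumes [measurable]: "E \<in> sets lebesgue" "h \<in> borel_measurable lebesgue"
    and E: "E \<subseteq> W" "emeasure lebesgue E > 0"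
  obtains J k where "J \<in> sets lebesgue" "J \<subseteq> E" "emeasure lebesgue J > 0"
    "0 \<le> k" "\<And>x. x \<in> J \<Longrightarrow> h x \<le> k" "ennreal k * emeasure lebesgue J \<le> ennreal (1/2)"
proof -
  define cell where "cell k i = {real i / real (2 * Suc k)..<real (Suc i) / real (2 * Suc k)}" for k i
  define J where "J k i = {x \<in> E. h x \<le> real (Suc k)} \<inter> cell k i" for k i
  have [measurable]: "cell k i \<in> sets lebesgue" for k i
    by (simp add: cell_def)
  have meas: "J k i \<in> sets lebesgue" for k i
  proof -
    have "J k i = (E \<inter> (h -` {..real (Suc k)} \<inter> space lebesgue)) \<inter> cell k i"
      by (auto simp: J_def)
    also have "\<dots> \<in> sets lebesgue" by measurable
    finally show ?thesis .
  qed
  have cover: "E \<subseteq> (\<Union>k. \<Union>i. J k i)"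
  proof
    fix x assume x: "x \<in> E"
    then have "0 \<le> x" using E by (auto simp: W_def)
    obtain k where k: "h x \<le> real k" using real_arch_simple by blast
    define i where "i = nat \<lfloor>x * real (2 * Suc k)\<rfloor>"
    have "0 \<le> x * real (2 * Suc k)" using \<open>0 \<le> x\<close> by simp
    then have "real i \<le> x * real (2 * Suc k)" "x * real (2 * Suc k) < real (Suc i)"
      unfolding i_def by linarith+
    then have "x \<in> cell k i"
      unfolding cell_def atLeastLessThan_iff
      by (subst pos_divide_le_eq pos_less_divide_eq; simp del: of_nat_Suc mult_Suc mult_Suc_right)+
    with x k have "x \<in> J k i" by (auto simp: J_def)
    then show "x \<in> (\<Union>k. \<Union>i. J k i)" by blast
  qed
  have "\<exists>k i. emeasure lebesgue (J k i) > 0"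
  proof (rule ccontr)
    assume "\<not> ?thesis"
    then have "J k i \<in> null_sets lebesgue" for k i
      using meas by (auto simp: null_sets_def not_less)
    then have "(\<Union>k. \<Union>i. J k i) \<in> null_sets lebesgue" by auto
    then have "E \<in> null_sets lebesgue"
      using cover by (auto intro: null_sets_subset)
    then show False using E(2) by (auto simp: null_sets_def)
  qed
  then obtain k i where ki: "emeasure lebesgue (J k i) > 0" by blast
  have "emeasure lebesgue (J k i) \<le> emeasure lebesgue (cell k i)"
    by (rule emeasure_mono) (auto simp: J_def)
  also have "\<dots> = ennreal (1 / real (2 * Suc k))"
    unfolding cell_def by (subst emeasure_completion, simp) 
      (auto simp: divide_right_mono diff_divide_distrib[symmetric] simp del: mult_Suc_right)
  finally have "ennreal (real (Suc k)) * emeasure lebesgue (J k i)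
      \<le> ennreal (real (Suc k)) * ennreal (1 / real (2 * Suc k))"
    by (rule mult_left_mono) simp
  also have "\<dots> = ennreal (real (Suc k) * (1 / real (2 * Suc k)))"
    by (rule ennreal_mult[symmetric]) auto
  also have "real (Suc k) * (1 / real (2 * Suc k)) = 1/2"
    by (simp add: field_simps)
  finally show ?thesis
    using ki meas by (intro that[of "J k i" "real (Suc k)"]) (auto simp: J_def simp del: of_nat_Suc)
qed

text \<open>A density \<open>g\<close> of \<open>E \<mapsto> indicator_class E\<close> would be approximated in \<open>L\<^sup>1\<close> by a simple
  function \<open>s\<close>. On a set \<open>J\<close> so small that all values of \<open>s\<close> carry little mass on \<open>J\<close>, the integral
  of \<open>s\<close> over \<open>J\<close> cannot be close to \<open>indicator_class J\<close>.\<close>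

theorem not_radon_nikodym:
  "\<not> radon_nikodym_property TYPE(real) (Ces p I) (ces_norm p I)"
proof
  let ?M = "lebesgue_on W" and ?V = "Ces p I" and ?N = "ces_norm p I"
  assume "radon_nikodym_property TYPE(real) (Ces p I) (ces_norm p I)"
  then obtain g where g: "\<And>E. E \<in> sets ?M \<Longrightarrow>
      has_bochner_integral_in ?V ?N ?M (\<lambda>w. indicator E w *\<^sub>R g w) (indicator_class E)"
    using finite_measure_window vector_measure_indicator_class continuous_wrt_indicator_class
      bounded_variation_indicator_class
    unfolding radon_nikodym_property_def by blast
  interpret finite_measure ?M by (rule finite_measure_window)
  let ?g = "\<lambda>w. indicator W w *\<^sub>R g w"
  have "W \<in> sets ?M" by (simp add: sets_window)
  from g[OF this] obtain t where t: "\<And>i::nat. Bochner_Integration.simple_bochner_integrable ?M (t i)" "\<And>i. t i \<in> space ?M \<rightarrow> ?V"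
    and lim: "(\<lambda>i. \<integral>\<^sup>+w. ennreal (?N (?g w - t i w)) \<partial>?M) \<longlonglongrightarrow> 0"
    and sm: "strongly_measurable ?V ?N ?M ?g"
    unfolding has_bochner_integral_in_def by blast
  \<comment> \<open>From 1/64 one gets 1/32 as a bound for the integral of \<open>u\<close>, and by
    Markov's inequality at level 1/4 the set where \<open>u\<close> exceeds 1/4 has measure at most
    1/8. This is less than the measure 1/4 of \<open>W\<close>, so \<open>E\<close> has positive
    measure.\<close>
  have "eventually (\<lambda>i. (\<integral>\<^sup>+w. ennreal (?N (?g w - t i w)) \<partial>?M) < ennreal (1/64)) sequentially"
    by (rule order_tendstoD(2)[OF lim]) simp
  then obtain i where i: "(\<integral>\<^sup>+w. ennreal (?N (?g w - t i w)) \<partial>?M) < ennreal (1/64)"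
    by (auto simp: eventually_sequentially)
  define s where "s = t i"
  have s: "simple_function ?M s" "s \<in> space ?M \<rightarrow> ?V"
    using t by (auto simp: s_def elim: simple_bochner_integrable.cases)
  obtain u where [measurable]: "u \<in> borel_measurable ?M" and u: "AE w in ?M. mass W (?g w - s w) = u w"
    "(\<integral>\<^sup>+w. u w \<partial>?M) \<le> 2 * (\<integral>\<^sup>+w. ennreal (?N (?g w - s w)) \<partial>?M)"
    by (rule strongly_measurable_mass[OF sm s])
  have gu: "AE w in ?M. mass W (g w - s w) = u w"
    using u(1) AE_space by eventually_elim simp
  have "(\<integral>\<^sup>+w. u w \<partial>?M) \<le> 2 * ennreal (1/64)"
    using i by (intro order_trans[OF u(2)] mult_left_mono) (auto simp: s_def)
  then have int_u: "(\<integral>\<^sup>+w. u w \<partial>?M) \<le> ennreal (1/32)"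
    by (subst (asm) numeral_mult_ennreal) auto
  define E where "E = {w \<in> space ?M. u w \<le> ennreal (1/4)}"
  have E: "E \<in> sets ?M" unfolding E_def by measurable
  have "emeasure ?M (space ?M - E) \<le> emeasure ?M {w \<in> space ?M. 1 \<le> 4 * u w}"
  proof (rule emeasure_mono)
    show "space ?M - E \<subseteq> {w \<in> space ?M. 1 \<le> 4 * u w}"
    proof
      fix w assume w: "w \<in> space ?M - E"
      then have "ennreal (1/4) \<le> u w" by (auto simp: E_def)
      then have "4 * ennreal (1/4) \<le> 4 * u w" by (rule mult_left_mono) simp
      then show "w \<in> {w \<in> space ?M. 1 \<le> 4 * u w}"
        using w by (subst (asm) numeral_mult_ennreal) auto
    qed
  qed measurable
  also have "\<dots> \<le> 4 * (\<integral>\<^sup>+w. u w * indicator (space ?M) w \<partial>?M)"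
    by (rule nn_integral_Markov_inequality, measurable)
  also have "\<dots> = 4 * (\<integral>\<^sup>+w. u w \<partial>?M)"
    by (intro arg_cong[where f = "\<lambda>x. 4 * x"] nn_integral_cong) auto
  also have "\<dots> \<le> 4 * ennreal (1/32)" by (intro mult_left_mono int_u) simp
  also have "\<dots> = ennreal (1/8)" by (subst numeral_mult_ennreal) auto
  finally have compl: "emeasure ?M (space ?M - E) \<le> ennreal (1/8)" .
  have "emeasure lebesgue E > 0"
  proof (rule ccontr)
    assume "\<not> ?thesis"
    then have "emeasure ?M E = 0" using E by (simp add: emeasure_window)
    then have "emeasure ?M (space ?M) = emeasure ?M (space ?M - E)"
      using emeasure_Diff_null_set[of E ?M "space ?M"] E by (auto simp: null_sets_def)
    moreover have "emeasure ?M (space ?M) = ennreal (1/4)"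
      using \<open>W \<in> sets ?M\<close> by (simp add: emeasure_window emeasure_W)
    ultimately show False using compl by simp
  qed
  define R where "R = s ` space ?M"
  have R: "finite R" using s(1) by (simp add: R_def simple_function_def)
  \<comment> \<open>Summing over the finitely many values of \<open>s\<close> bounds their masses on
    \<open>J\<close> all at once.\<close>
  define h where "h x = (\<Sum>F\<in>R. \<bar>rep_lfun F x\<bar>)" for x
  have [measurable]: "h \<in> borel_measurable lebesgue"
    unfolding h_def[abs_def] by measurable
  obtain J k where J: "J \<in> sets lebesgue" "J \<subseteq> E" "emeasure lebesgue J > 0"
    and k: "0 \<le> k" "\<And>x. x \<in> J \<Longrightarrow> h x \<le> k" "ennreal k * emeasure lebesgue J \<le> ennreal (1/2)"
    using exists_small_set[of E h] E \<open>emeasure lebesgue E > 0\<close> by (auto simp: sets_window)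
  have JM: "J \<in> sets ?M" and JW: "J \<subseteq> W"
    using J E by (auto simp: sets_window)
  note [measurable] = J(1) JM
  have h_mass: "(\<Sum>F\<in>R. mass J F) \<le> ennreal (1/2)"
  proof -
    have "(\<Sum>F\<in>R. mass J F) = (\<Sum>F\<in>R. \<integral>\<^sup>+x. ennreal \<bar>rep_lfun F x\<bar> * indicator J x \<partial>lebesgue)"
      by (intro sum.cong refl) (metis mass_abs abs_rep_lfun rep_lfun_measurable)
    also have "\<dots> = (\<integral>\<^sup>+x. (\<Sum>F\<in>R. ennreal \<bar>rep_lfun F x\<bar> * indicator J x) \<partial>lebesgue)"
      by (rule nn_integral_sum[symmetric]) measurable
    also have "\<dots> \<le> (\<integral>\<^sup>+x. ennreal k * indicator J x \<partial>lebesgue)"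
    proof (rule nn_integral_mono)
      fix x
      have "(\<Sum>F\<in>R. ennreal \<bar>rep_lfun F x\<bar> * indicator J x) = ennreal (h x) * indicator J x"
        by (simp add: h_def sum_distrib_right[symmetric])
      also have "\<dots> \<le> ennreal k * indicator J x"
        using k by (auto split: split_indicator intro: ennreal_leI)
      finally show "(\<Sum>F\<in>R. ennreal \<bar>rep_lfun F x\<bar> * indicator J x) \<le> ennreal k * indicator J x" .
    qed
    also have "\<dots> = ennreal k * emeasure lebesgue J"
      by (rule nn_integral_cmult_indicator) auto
    finally show ?thesis using k(3) by simp
  qed
  obtain m where m: "0 < m" "emeasure lebesgue J = ennreal m" "emeasure ?M J = ennreal m"
    using J(3) emeasure_window[OF JM] emeasure_eq_measure[of J]
    by (metis ennreal_less_zero_iff)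
  have "mass J (indicator_class J) = (\<integral>\<^sup>+x. indicator J x \<partial>lebesgue)"
    unfolding indicator_class_def
    by (subst mass_abs, measurable, intro nn_integral_cong) (auto split: split_indicator)
  then have mass_J: "mass J (indicator_class J) = ennreal m"
    by (simp add: m)
  \<comment> \<open>The contradiction is \<open>m \<le> m/4 + m/2\<close>: the first term bounds the
    contribution of \<open>g - s\<close>, where \<open>u \<le> 1/4\<close> on \<open>J\<close>, and
    the second that of \<open>s\<close>, whose values have mass at most 1/2 on
    \<open>J\<close>.\<close>
  have quarters: "ennreal (1/4) + ennreal (1/2) = ennreal (3/4)"
    by (subst ennreal_plus[symmetric]) auto
  have "ennreal m = mass J (indicator_class J)" by (rule mass_J[symmetric])
  also have "\<dots> \<le> (\<integral>\<^sup>+w. u w * indicator J w \<partial>?M) + (\<integral>\<^sup>+w. mass J (indicator J w *\<^sub>R s w) \<partial>?M)"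
    by (rule mass_bochner_integral_le[OF finite_measure_window JM g[OF JM] s _ gu J(1) JW]) simp
  also have "(\<integral>\<^sup>+w. u w * indicator J w \<partial>?M) \<le> (\<integral>\<^sup>+w. ennreal (1/4) * indicator J w \<partial>?M)"
    using J(2) by (intro nn_integral_mono) (auto simp: E_def split: split_indicator)
  also have "\<dots> = ennreal (1/4) * emeasure ?M J"
    by (rule nn_integral_cmult_indicator) auto
  also have "(\<integral>\<^sup>+w. mass J (indicator J w *\<^sub>R s w) \<partial>?M) \<le> (\<integral>\<^sup>+w. ennreal (1/2) * indicator J w \<partial>?M)"
  proof (rule nn_integral_mono)
    fix w assume w: "w \<in> space ?M"
    have "mass J (s w) \<le> (\<Sum>F\<in>R. mass J F)"
      using w R by (intro member_le_sum) (auto simp: R_def)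
    with h_mass show "mass J (indicator J w *\<^sub>R s w) \<le> ennreal (1/2) * indicator J w"
      by (auto split: split_indicator)
  qed
  also have "\<dots> = ennreal (1/2) * emeasure ?M J"
    by (rule nn_integral_cmult_indicator) auto
  also have "ennreal (1/4) * emeasure ?M J + ennreal (1/2) * emeasure ?M J = ennreal (3/4 * m)"
    unfolding m(3) distrib_right[symmetric] quarters
    by (rule ennreal_mult[symmetric]) (use m(1) in auto)
  finally have "ennreal m \<le> ennreal (3/4 * m)"
    by (simp add: add_mono)
  then show False using m(1) by (simp add: ennreal_le_iff)
qed

end

section \<open>Failure of duality\<close>

text \<open>Functions carry the topology of pointwise convergence, which on continuous linear
  functionals is the weak* topology. The lemma extracts its basic neighbourhoods, given by finitely
  many points and one tolerance.\<close>

lemma open_fun_neighbourhood: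
  fixes U :: "('a \<Rightarrow> real) set"
  assumes "open U" "\<phi> \<in> U"
  obtains Y \<delta> where "finite Y" "0 < \<delta>" "\<And>\<psi>. (\<And>y. y \<in> Y \<Longrightarrow> \<bar>\<psi> y - \<phi> y\<bar> < \<delta>) \<Longrightarrow> \<psi> \<in> U"
proof -
  have "openin (product_topology (\<lambda>_. euclidean) UNIV) U"
    using assms(1) by (simp add: euclidean_product_topology)
  from product_topology_open_contains_basis[OF this assms(2)]
  obtain X where X: "\<phi> \<in> (\<Pi>\<^sub>E i\<in>UNIV. X i)" "\<And>i. open (X i)" "finite {i. X i \<noteq> UNIV}"
    "(\<Pi>\<^sub>E i\<in>UNIV. X i) \<subseteq> U"
    by auto
  let ?Y = "{i. X i \<noteq> UNIV}"
  have "\<exists>\<delta>>0. \<forall>t. \<bar>t - \<phi> i\<bar> < \<delta> \<longrightarrow> t \<in> X i" for i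
    using X(1) X(2)[of i] by (auto simp: open_dist dist_real_def PiE_iff)
  then obtain d where d: "\<And>i. d i > 0" "\<And>i t. \<bar>t - \<phi> i\<bar> < d i \<Longrightarrow> t \<in> X i"
    by metis
  \<comment> \<open>The inserted 1 keeps the minimum defined when no coordinate is
    restricted.\<close>
  define \<delta> where "\<delta> = Min (insert 1 (d ` ?Y))"
  have \<delta>: "\<delta> \<le> d i" if "i \<in> ?Y" for i
    unfolding \<delta>_def using X(3) that by (intro Min_le) auto
  show ?thesis
  proof (rule that[of ?Y \<delta>])
    show "0 < \<delta>"
      unfolding \<delta>_def using X(3) d(1) by (subst Min_gr_iff) auto
    fix \<psi> assume near: "\<And>y. y \<in> ?Y \<Longrightarrow> \<bar>\<psi> y - \<phi> y\<bar> < \<delta>"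
    have "\<psi> i \<in> X i" for i
    proof (cases "i \<in> ?Y")
      case True
      then show ?thesis using near[OF True] \<delta>[OF True] by (intro d(2)) linarith
    qed auto
    then show "\<psi> \<in> U" using X(4) by auto
  qed (fact X(3))
qed

text \<open>The weak* closure of \<open>S\<close> is compact, and it is covered by countably many norm balls, which are
  weak* closed. By Baire's theorem one of them has interior points in this closure.\<close>

lemma separable_dual_small_slice:
  fixes S D :: "('y::real_normed_vector \<Rightarrow>\<^sub>L real) set"
  assumes S: "bounded S" "S \<noteq> {}"
    and D: "countable D" "\<And>\<xi> e. 0 < e \<Longrightarrow> \<exists>d\<in>D. norm (\<xi> - d) < e"
    and \<epsilon>: "0 < \<epsilon>"
  obtains \<xi>0 Y \<delta> where "\<xi>0 \<in> S" "finite Y" "0 < \<delta>"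
    "\<And>\<xi>. \<xi> \<in> S \<Longrightarrow> \<forall>y\<in>Y. \<bar>blinfun_apply \<xi> y - blinfun_apply \<xi>0 y\<bar> < \<delta> \<Longrightarrow> norm (\<xi> - \<xi>0) \<le> \<epsilon>"
proof -
  obtain R where R: "\<And>\<xi>. \<xi> \<in> S \<Longrightarrow> norm \<xi> \<le> R"
    using S(1) by (auto simp: bounded_iff)
  have ev: "continuous_on UNIV (\<lambda>\<phi> :: 'y \<Rightarrow> real. \<phi> y)" for y
    by (rule continuous_on_product_coordinates)
  have add_closed: "closed {\<phi> :: 'y \<Rightarrow> real. \<phi> (x + y) = \<phi> x + \<phi> y}" for x y
    by (rule closed_Collect_eq[OF ev continuous_on_add[OF ev ev]])
  have scale_closed: "closed {\<phi> :: 'y \<Rightarrow> real. \<phi> (c *\<^sub>R x) = c * \<phi> x}" for c x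
    by (rule closed_Collect_eq[OF ev continuous_on_mult_left[OF ev]])
  have near_closed: "closed {\<phi> :: 'y \<Rightarrow> real. \<bar>\<phi> y - b\<bar> \<le> c}" for y b c
    by (rule closed_Collect_le[OF continuous_on_rabs[OF continuous_on_diff[OF ev continuous_on_const]] continuous_on_const])
  define K where "K = closure (blinfun_apply ` S)"
  \<comment> \<open>Linearity and the norm bound are closed conditions for pointwise convergence.
    Hence every point of the closure is again a functional in the dual, which the covering by balls
    around points of \<open>D\<close> needs.\<close>
  define L where "L = {\<phi> :: 'y \<Rightarrow> real. (\<forall>x y. \<phi> (x + y) = \<phi> x + \<phi> y) \<and> (\<forall>c x. \<phi> (c *\<^sub>R x) = c * \<phi> x)}"
  define B where "B = {\<phi> :: 'y \<Rightarrow> real. \<forall>y. \<bar>\<phi> y\<bar> \<le> R * norm y}"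
  have "closed L"
    unfolding L_def by (intro closed_Collect_conj closed_Collect_all add_closed scale_closed)
  moreover have "blinfun_apply ` S \<subseteq> L"
    by (auto simp: L_def blinfun.add_right blinfun.scaleR_right)
  ultimately have KL: "K \<subseteq> L" unfolding K_def by (rule closure_minimal[rotated])
  have "closed B"
    unfolding B_def using near_closed[of _ 0] by (intro closed_Collect_all) simp
  moreover have "blinfun_apply ` S \<subseteq> B"
  proof clarify
    fix \<xi> assume "\<xi> \<in> S"
    then have "\<bar>blinfun_apply \<xi> y\<bar> \<le> R * norm y" for y
      using norm_blinfun[of \<xi> y] mult_right_mono[OF R norm_ge_zero, of \<xi> y] by simp
    then show "blinfun_apply \<xi> \<in> B" by (simp add: B_def)
  qed
  ultimately have KB: "K \<subseteq> B" unfolding K_def by (rule closure_minimal[rotated])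
  \<comment> \<open>The Banach-Alaoglu argument: \<open>B\<close> is a product of compact
    intervals.\<close>
  have "compactin (product_topology (\<lambda>_. euclidean) UNIV) (\<Pi>\<^sub>E y\<in>UNIV. cball 0 (R * norm (y :: 'y)) :: real set)"
    by (simp add: compactin_PiE)
  moreover have "(\<Pi>\<^sub>E y\<in>UNIV. cball 0 (R * norm (y :: 'y)) :: real set) = B"
    by (auto simp: B_def PiE_iff)
  ultimately have "compact B"
    by (simp add: euclidean_product_topology)
  then have "compact K"
    using KB compact_Int_closed[of B K] by (simp add: K_def Int_absorb1)
  let ?X = "subtopology euclidean K :: ('y \<Rightarrow> real) topology"
  have "Hausdorff_space (product_topology (\<lambda>_ :: 'y. euclidean :: real topology) UNIV)"
    by (simp add: Hausdorff_space_product_topology)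
  then have "Hausdorff_space (euclidean :: ('y \<Rightarrow> real) topology)"
    by (simp add: euclidean_product_topology)
  with \<open>compact K\<close> have X: "compact_space ?X" "Hausdorff_space ?X"
    by (auto simp: compact_space_subtopology Hausdorff_space_subtopology)
  \<comment> \<open>The radius is \<open>\<epsilon> / 2\<close> so that two members differ by at
    most \<open>\<epsilon>\<close> in norm. Written pointwise, the condition is visibly weak*
    closed.\<close>
  define ball where "ball d = {\<phi>. \<forall>y. \<bar>\<phi> y - blinfun_apply d y\<bar> \<le> \<epsilon> / 2 * norm y}" for d :: "'y \<Rightarrow>\<^sub>L real"
  have ball_closed: "closed (ball d)" for d
    unfolding ball_def by (intro closed_Collect_all near_closed)
  have cover: "K \<subseteq> (\<Union>d\<in>D. K \<inter> ball d)"
  proof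
    fix \<phi> assume \<phi>: "\<phi> \<in> K"
    then have "bounded_linear \<phi>"
      using KL KB by (intro bounded_linear_intro[where K = R]) (auto simp: L_def B_def mult.commute)
    then obtain \<xi> where \<xi>: "\<phi> = blinfun_apply \<xi>"
      by (metis bounded_linear_Blinfun_apply)
    obtain d where d: "d \<in> D" "norm (\<xi> - d) < \<epsilon> / 2" using D(2)[of "\<epsilon> / 2" \<xi>] \<epsilon> by auto
    have "\<bar>\<phi> y - blinfun_apply d y\<bar> \<le> \<epsilon> / 2 * norm y" for y
    proof -
      have "\<bar>\<phi> y - blinfun_apply d y\<bar> \<le> norm (\<xi> - d) * norm y"
        using norm_blinfun[of "\<xi> - d" y] by (simp add: \<xi> blinfun.diff_left)
      also have "\<dots> \<le> \<epsilon> / 2 * norm y" using d by (intro mult_right_mono) auto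
      finally show ?thesis .
    qed
    then show "\<phi> \<in> (\<Union>d\<in>D. K \<inter> ball d)" using d \<phi> by (auto simp: ball_def)
  qed
  have "\<exists>d\<in>D. ?X interior_of (K \<inter> ball d) \<noteq> {}"
  proof (rule ccontr)
    assume "\<not> ?thesis"
    then have "?X interior_of \<Union>((\<lambda>d. K \<inter> ball d) ` D) = {}"
      using D(1) X ball_closed
      by (intro Baire_category_alt)
        (auto simp: compact_imp_locally_compact_space compact_Hausdorff_imp_regular_space closedin_closed_Int)
    moreover have "\<Union>((\<lambda>d. K \<inter> ball d) ` D) = topspace ?X"
      using cover by auto
    ultimately have "K = {}" by (metis interior_of_topspace topspace_euclidean_subtopology)
    then show False using S(2) by (simp add: K_def)
  qed
  then obtain d U where U: "open U" "K \<inter> U \<noteq> {}" "K \<inter> U \<subseteq> ball d"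
    by (auto simp: interior_of_def openin_open)
  \<comment> \<open>An open set that meets the closure of the image of \<open>S\<close> meets the
    image itself, so the centre can be taken in \<open>S\<close>.\<close>
  then obtain \<xi>0 where \<xi>0: "\<xi>0 \<in> S" "blinfun_apply \<xi>0 \<in> U"
    using open_Int_closure_eq_empty[OF U(1), of "blinfun_apply ` S"] by (auto simp: K_def)
  obtain Y \<delta> where Y: "finite Y" "0 < \<delta>"
    "\<And>\<psi>. (\<And>y. y \<in> Y \<Longrightarrow> \<bar>\<psi> y - blinfun_apply \<xi>0 y\<bar> < \<delta>) \<Longrightarrow> \<psi> \<in> U"
    using open_fun_neighbourhood[OF U(1) \<xi>0(2)] by blast
  show ?thesis
  proof (rule that[OF \<xi>0(1) Y(1,2)])
    fix \<xi> assume \<xi>: "\<xi> \<in> S" "\<forall>y\<in>Y. \<bar>blinfun_apply \<xi> y - blinfun_apply \<xi>0 y\<bar> < \<delta>"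
    have SK: "blinfun_apply \<zeta> \<in> K" if "\<zeta> \<in> S" for \<zeta>
      unfolding K_def by (rule subsetD[OF closure_subset imageI[OF that]])
    have "blinfun_apply \<xi> \<in> U"
      by (rule Y(3)) (use \<xi>(2) in blast)
    then have "blinfun_apply \<xi> \<in> ball d" "blinfun_apply \<xi>0 \<in> ball d"
      using U(3) SK[OF \<xi>(1)] SK[OF \<xi>0(1)] \<xi>0(2) by blast+
    then have b: "\<bar>blinfun_apply \<xi> y - blinfun_apply d y\<bar> \<le> \<epsilon> / 2 * norm y"
      "\<bar>blinfun_apply \<xi>0 y - blinfun_apply d y\<bar> \<le> \<epsilon> / 2 * norm y" for y
      by (auto simp: ball_def)
    show "norm (\<xi> - \<xi>0) \<le> \<epsilon>"
    proof (rule norm_blinfun_bound)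
      fix y
      have "\<bar>blinfun_apply \<xi> y - blinfun_apply \<xi>0 y\<bar> \<le> \<epsilon> / 2 * norm y + \<epsilon> / 2 * norm y"
        using b[of y] by linarith
      then show "norm (blinfun_apply (\<xi> - \<xi>0) y) \<le> \<epsilon> * norm y"
        by (simp add: blinfun.diff_left)
    qed (use \<epsilon> in simp)
  qed
qed

context cesaro_space
begin

section \<open>Bounded functions on the window and oscillating signs\<close>

definition window_function :: "(real \<Rightarrow> real) \<Rightarrow> bool" where
  "window_function f \<longleftrightarrow> f \<in> borel_measurable lebesgue \<and> (\<exists>M. \<forall>x. \<bar>f x\<bar> \<le> M * indicator W x)"

lemma window_function_measurable [measurable_dest]:
  "window_function f \<Longrightarrow> f \<in> borel_measurable lebesgue"
  by (simp add: window_function_def)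

lemma window_function_off:
  assumes "window_function f" "x \<notin> W" shows "f x = 0"
proof -
  obtain M where "\<And>x. \<bar>f x\<bar> \<le> M * indicator W x"
    using assms(1) by (auto simp: window_function_def)
  from this[of x] show ?thesis using assms(2) by simp
qed

lemma window_function_mult:
  assumes f: "window_function f" and [measurable]: "g \<in> borel_measurable lebesgue" and g: "\<And>x. \<bar>g x\<bar> \<le> B"
  shows "window_function (\<lambda>x. f x * g x)"
proof -
  obtain M where M: "\<And>x. \<bar>f x\<bar> \<le> M * indicator W x"
    using f by (auto simp: window_function_def)
  have "\<bar>f x * g x\<bar> \<le> (M * B) * indicator W x" for x
    using mult_mono[OF M[of x] g[of x]] order_trans[OF abs_ge_zero M] by (simp add: abs_mult ac_simps)
  with f show ?thesis by (auto simp: window_function_def)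
qed

lemma window_function_add:
  assumes f: "window_function f" and g: "window_function g"
  shows "window_function (\<lambda>x. f x + g x)"
proof -
  obtain M M' where M: "\<And>x. \<bar>f x\<bar> \<le> M * indicator W x" "\<And>x. \<bar>g x\<bar> \<le> M' * indicator W x"
    using f g by (auto simp: window_function_def)
  have "\<bar>f x + g x\<bar> \<le> (M + M') * indicator W x" for x
    using M[of x] by (auto simp: distrib_right)
  with f g show ?thesis by (auto simp: window_function_def)
qed

lemma window_function_scale: "window_function f \<Longrightarrow> window_function (\<lambda>x. c * f x)"
  using window_function_mult[of f "\<lambda>_. c" "\<bar>c\<bar>"] by (simp add: mult.commute)

lemma window_function_diff:
  "window_function f \<Longrightarrow> window_function g \<Longrightarrow> window_function (\<lambda>x. f x - g x)"
  using window_function_add[of f "\<lambda>x. -1 * g x"] window_function_scale[of g "-1"] by simp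

lemma window_function_integrable: "window_function f \<Longrightarrow> integrable lebesgue f"
proof -
  assume f: "window_function f"
  then obtain M where M: "\<And>x. \<bar>f x\<bar> \<le> M * indicator W x"
    by (auto simp: window_function_def)
  show "integrable lebesgue f"
  proof (rule Bochner_Integration.integrable_bound)
    show "integrable lebesgue (\<lambda>x. M * indicator W x)"
      by (intro integrable_mult_right integrable_real_indicator) (auto simp: emeasure_W)
    show "AE x in lebesgue. norm (f x) \<le> norm (M * indicator W x)"
      using M order_trans[OF M abs_ge_self] by (intro AE_I2) simp
  qed (use f in measurable)
qed

lemma window_function_Ces:
  assumes f: "window_function f"
  shows "abs_lfun f \<in> Ces p I"
    and "ces_norm p I (abs_lfun f) \<le> enn2real (tail (1/4)) powr (1/p) * (\<integral>x. \<bar>f x\<bar> \<partial>lebesgue)"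
proof -
  have "(\<integral>\<^sup>+x. ennreal \<bar>f x\<bar> \<partial>lebesgue) = ennreal (\<integral>x. \<bar>f x\<bar> \<partial>lebesgue)"
    using window_function_integrable[OF f] by (intro nn_integral_eq_integral) auto
  then show "abs_lfun f \<in> Ces p I"
    "ces_norm p I (abs_lfun f) \<le> enn2real (tail (1/4)) powr (1/p) * (\<integral>x. \<bar>f x\<bar> \<partial>lebesgue)"
    using window_in_Ces[of f "\<integral>x. \<bar>f x\<bar> \<partial>lebesgue"] f window_function_off[OF f] by auto
qed

text \<open>The signs are chosen cell by cell: since \<open>Q (u + v) + Q (u - v) = 2 * Q u + 2 * Q v\<close> for the
  quadratic form \<open>Q = \<Sum>(\<psi> i)\<^sup>2\<close>, one of the two signs adds at most \<open>Q v\<close>, which is of second order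
  in the length of the cell.\<close>

lemma oscillation:
  fixes \<psi> :: "'i \<Rightarrow> (real \<Rightarrow> real) \<Rightarrow> real"
  assumes Y: "finite Y" and B: "0 \<le> B"
    and add: "\<And>i f g. i \<in> Y \<Longrightarrow> window_function f \<Longrightarrow> window_function g \<Longrightarrow> \<psi> i (\<lambda>x. f x + g x) = \<psi> i f + \<psi> i g"
    and diff: "\<And>i f g. i \<in> Y \<Longrightarrow> window_function f \<Longrightarrow> window_function g \<Longrightarrow> \<psi> i (\<lambda>x. f x - g x) = \<psi> i f - \<psi> i g"
    and bound: "\<And>i f. i \<in> Y \<Longrightarrow> window_function f \<Longrightarrow> \<bar>\<psi> i f\<bar> \<le> B * (\<integral>x. \<bar>f x\<bar> \<partial>lebesgue)"
    and f: "window_function f" and \<delta>: "0 < \<delta>"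
  obtains r where "r \<in> borel_measurable lebesgue" "\<And>x. \<bar>r x\<bar> = 1"
    "\<And>i. i \<in> Y \<Longrightarrow> \<bar>\<psi> i (\<lambda>x. f x * r x)\<bar> < \<delta>"
proof -
  obtain M where M: "\<And>x. \<bar>f x\<bar> \<le> M * indicator W x"
    using f by (auto simp: window_function_def)
  have "0 \<le> M" using order_trans[OF abs_ge_zero M[of "1/2"]] by (simp add: W_def)
  \<comment> \<open>One cell of length \<open>h\<close> contributes at most
    \<open>card Y * (B * M * h)\<^sup>2\<close>, that is \<open>c * h\<^sup>2\<close>. With
    \<open>n\<close> cells of length \<open>1 / (4 * n)\<close> the total is
    \<open>c / (16 * n)\<close>, which is below \<open>\<delta>\<^sup>2\<close> for the chosen
    \<open>n\<close>.\<close>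
  define c where "c = real (card Y) * (B * M)\<^sup>2"
  obtain n where n: "c / \<delta>\<^sup>2 < real n" using reals_Archimedean2 by blast
  have "0 \<le> c / \<delta>\<^sup>2" by (simp add: c_def)
  then have n_pos: "0 < real n" using n by linarith
  define h where "h = 1 / (4 * real n)"
  define a where "a j = 1/4 + real j * h" for j
  have h_pos: "0 < h" using n_pos by (simp add: h_def)
  have a_Suc: "a (Suc j) = a j + h" for j by (simp add: a_def algebra_simps)
  define Q where "Q u = (\<Sum>i\<in>Y. (\<psi> i u)\<^sup>2)" for u
  \<comment> \<open>Stage \<open>j\<close> controls only the part of \<open>f\<close> on the first
    \<open>j\<close> cells; the values of \<open>r\<close> further right are provisional. As
    \<open>a 0\<close> is the left end of \<open>W\<close> and \<open>a n\<close> its right end,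
    stage \<open>n\<close> controls all of \<open>f\<close>.\<close>
  have "\<exists>r. r \<in> borel_measurable lebesgue \<and> (\<forall>x. \<bar>r x\<bar> = 1) \<and>
      Q (\<lambda>x. f x * (r x * indicator {..a j} x)) \<le> real j * (c * h\<^sup>2)" for j
  proof (induction j)
    case 0
    have z: "f x * indicator {..a 0} x = 0" for x
      using window_function_off[OF f, of x] by (auto simp: a_def W_def split: split_indicator)
    have "window_function (\<lambda>_. 0)" by (auto simp: window_function_def intro: exI[of _ 0])
    from bound[OF _ this] have "\<psi> i (\<lambda>_. 0) = 0" if "i \<in> Y" for i using that by simp
    then have "Q (\<lambda>x. f x * (1 * indicator {..a 0} x)) = 0" by (simp add: Q_def z)
    then show ?case by (intro exI[of _ "\<lambda>_. 1"]) simp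
  next
    case (Suc j)
    then obtain r where [measurable]: "r \<in> borel_measurable lebesgue" and r: "\<And>x. \<bar>r x\<bar> = 1"
      and Qr: "Q (\<lambda>x. f x * (r x * indicator {..a j} x)) \<le> real j * (c * h\<^sup>2)" by blast
    define u where "u x = f x * (r x * indicator {..a j} x)" for x
    define v where "v x = f x * indicator {a j<..a (Suc j)} x" for x
    have [measurable]: "{..a j} \<in> sets lebesgue" "{a j<..a (Suc j)} \<in> sets lebesgue" by auto
    have u: "window_function u"
      unfolding u_def using r
      by (intro window_function_mult[OF f, where B = 1]) (auto simp: abs_mult split: split_indicator)
    have v: "window_function v"
      unfolding v_def by (intro window_function_mult[OF f, where B = 1]) (auto split: split_indicator)
    have "(\<integral>x. \<bar>v x\<bar> \<partial>lebesgue) \<le> (\<integral>x. M * indicator {a j<..a (Suc j)} x \<partial>lebesgue)"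
    proof (rule integral_mono)
      show "integrable lebesgue (\<lambda>x. \<bar>v x\<bar>)" using window_function_integrable[OF v] by simp
      show "integrable lebesgue (\<lambda>x. M * indicator {a j<..a (Suc j)} x)"
        using h_pos by (intro integrable_mult_right integrable_real_indicator) (auto simp: a_Suc)
      show "\<bar>v x\<bar> \<le> M * indicator {a j<..a (Suc j)} x" for x
        using M[of x] \<open>0 \<le> M\<close> by (auto simp: v_def abs_mult split: split_indicator split_indicator_asm)
    qed
    also have "\<dots> = M * h"
      using h_pos by (simp add: a_Suc)
    finally have int_v: "(\<integral>x. \<bar>v x\<bar> \<partial>lebesgue) \<le> M * h" .
    have "Q v \<le> (\<Sum>i\<in>Y. (B * (M * h))\<^sup>2)"
      unfolding Q_def
    proof (rule sum_mono)
      fix i assume i: "i \<in> Y"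
      have "\<bar>\<psi> i v\<bar> \<le> B * (M * h)"
        using bound[OF i v] mult_left_mono[OF int_v B] by linarith
      then show "(\<psi> i v)\<^sup>2 \<le> (B * (M * h))\<^sup>2"
        by (simp add: abs_le_square_iff[symmetric])
    qed
    then have Qv: "Q v \<le> c * h\<^sup>2" by (simp add: c_def power_mult_distrib algebra_simps)
    have "Q (\<lambda>x. u x + v x) + Q (\<lambda>x. u x - v x) = 2 * Q u + 2 * Q v"
      using u v by (simp add: Q_def add diff sum.distrib[symmetric] sum_distrib_left power2_sum power2_diff)
    then have "Q (\<lambda>x. u x + v x) \<le> Q u + Q v \<or> Q (\<lambda>x. u x - v x) \<le> Q u + Q v"
      by linarith
    then obtain e :: real where e: "\<bar>e\<bar> = 1" "Q (\<lambda>x. u x + e * v x) \<le> Q u + Q v"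
    proof
      assume "Q (\<lambda>x. u x + v x) \<le> Q u + Q v"
      then show ?thesis by (intro that[of 1]) auto
    next
      assume "Q (\<lambda>x. u x - v x) \<le> Q u + Q v"
      then show ?thesis by (intro that[of "-1"]) auto
    qed
    define r' where "r' x = (if x \<in> {..a j} then r x else e)" for x
    have "f x * (r' x * indicator {..a (Suc j)} x) = u x + e * v x" for x
      using h_pos by (auto simp: u_def v_def r'_def a_Suc split: split_indicator)
    moreover have "Q u + Q v \<le> real (Suc j) * (c * h\<^sup>2)"
      using Qr Qv unfolding u_def[symmetric] by (simp add: algebra_simps)
    moreover have "r' \<in> borel_measurable lebesgue"
      unfolding r'_def by measurable
    ultimately show ?case
      using r e by (intro exI[of _ r']) (auto simp: r'_def)
  qed
  from this[of n] obtain r where [measurable]: "r \<in> borel_measurable lebesgue" and r: "\<And>x. \<bar>r x\<bar> = 1"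
    and Qr: "Q (\<lambda>x. f x * (r x * indicator {..a n} x)) \<le> real n * (c * h\<^sup>2)" by blast
  have "a n = 1/2" using n_pos by (simp add: a_def h_def field_simps)
  then have "f x * (r x * indicator {..a n} x) = f x * r x" for x
    using window_function_off[OF f, of x] by (auto simp: W_def split: split_indicator)
  with Qr have "Q (\<lambda>x. f x * r x) \<le> real n * (c * h\<^sup>2)" by simp
  also have "\<dots> = c / (16 * real n)"
    using n_pos by (simp add: h_def field_simps power2_eq_square)
  also have "\<dots> \<le> c / real n"
    using n_pos by (intro divide_left_mono) (auto simp: c_def)
  also have "\<dots> < \<delta>\<^sup>2"
    using n n_pos \<delta> by (simp add: field_simps)
  finally have Q_small: "Q (\<lambda>x. f x * r x) < \<delta>\<^sup>2" .
  show ?thesis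
  proof (rule that[of r])
    fix i assume i: "i \<in> Y"
    have "(\<psi> i (\<lambda>x. f x * r x))\<^sup>2 \<le> Q (\<lambda>x. f x * r x)"
      unfolding Q_def using Y i by (intro member_le_sum) auto
    then have "(\<psi> i (\<lambda>x. f x * r x))\<^sup>2 < \<delta>\<^sup>2" using Q_small by linarith
    then show "\<bar>\<psi> i (\<lambda>x. f x * r x)\<bar> < \<delta>"
      using \<delta> by (metis power2_abs power2_less_imp_less less_imp_le)
  qed (use r in auto)
qed


section \<open>Weak* small but norm large perturbations of densities\<close>

definition densities :: "(real \<Rightarrow> real) set" where
  "densities = {f. window_function f \<and> (\<forall>x. 0 \<le> f x) \<and> (\<integral>x. f x \<partial>lebesgue) = 1}"

lemma densities_nonempty: "densities \<noteq> {}"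
proof -
  have "window_function (\<lambda>x. 4 * indicator W x)"
    by (auto simp: window_function_def intro!: exI[of _ 4])
  moreover have "(\<integral>x. 4 * indicator W x \<partial>lebesgue) = (1::real)"
    by (simp add: measure_def emeasure_W)
  ultimately have "(\<lambda>x. 4 * indicator W x) \<in> densities"
    by (auto simp: densities_def)
  then show ?thesis by blast
qed

text \<open>The new density is \<open>g x = f x * (1 + (r x - s) / 2)\<close>, where
  \<open>s\<close> is the integral of \<open>f * r\<close>; subtracting \<open>s\<close> restores
  the integral 1. Once \<open>s\<close> is small,
  \<open>1/2 \<le> \<bar>r x - s\<bar> \<le> 2\<close>: the lower bound gives the distance 1/4, the
  upper one the nonnegativity of \<open>g\<close>.\<close>

lemma density_perturbation:
  fixes \<psi> :: "'i \<Rightarrow> (real \<Rightarrow> real) \<Rightarrow> real"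
  assumes Y: "finite Y" and B: "0 \<le> B"
    and add: "\<And>i f g. i \<in> Y \<Longrightarrow> window_function f \<Longrightarrow> window_function g \<Longrightarrow> \<psi> i (\<lambda>x. f x + g x) = \<psi> i f + \<psi> i g"
    and scale: "\<And>i f c. i \<in> Y \<Longrightarrow> window_function f \<Longrightarrow> \<psi> i (\<lambda>x. c * f x) = c * \<psi> i f"
    and bound: "\<And>i f. i \<in> Y \<Longrightarrow> window_function f \<Longrightarrow> \<bar>\<psi> i f\<bar> \<le> B * (\<integral>x. \<bar>f x\<bar> \<partial>lebesgue)"
    and f: "f \<in> densities" and \<delta>: "0 < \<delta>"
  obtains g where "g \<in> densities" "\<And>i. i \<in> Y \<Longrightarrow> \<bar>\<psi> i g - \<psi> i f\<bar> < \<delta>"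
    "1/4 \<le> (\<integral>x. \<bar>g x - f x\<bar> \<partial>lebesgue)"
proof -
  have fw: "window_function f" and f0: "\<And>x. 0 \<le> f x" and f1: "(\<integral>x. f x \<partial>lebesgue) = 1"
    using f by (auto simp: densities_def)
  \<comment> \<open>The bound 1/2 keeps \<open>s\<close> away from the values of \<open>r\<close>.
    The bound \<open>\<delta> / (1 + B)\<close> absorbs both the effect of \<open>f * r\<close> and
    that of the correction by \<open>s\<close>, whose size is governed by \<open>B\<close>.\<close>
  define \<delta>' where "\<delta>' = min (1/2) (\<delta> / (1 + B))"
  have "\<delta>' \<le> \<delta> / (1 + B)" "\<delta>' \<le> 1/2"
    unfolding \<delta>'_def by (rule min.cobounded2, rule min.cobounded1)
  moreover have "0 < \<delta>'"
    using \<delta> B by (simp add: \<delta>'_def)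
  ultimately have \<delta>': "0 < \<delta>'" "\<delta>' \<le> 1/2" "\<delta>' * (1 + B) \<le> \<delta>"
    using B by (simp_all add: pos_le_divide_eq)
  \<comment> \<open>\<open>None\<close> stands for integration, added to the given functionals so
    that one choice of signs also makes \<open>s\<close> small.\<close>
  define \<psi>' where "\<psi>' = case_option (\<lambda>f. \<integral>x. f x \<partial>lebesgue) \<psi>"
  note int = window_function_integrable
  have scale': "\<psi>' i (\<lambda>x. c * h x) = c * \<psi>' i h" if "i \<in> insert None (Some ` Y)" "window_function h" for i c h
  proof (cases i)
    case (Some j)
    then show ?thesis using that by (simp add: \<psi>'_def scale image_iff)
  qed (simp add: \<psi>'_def)
  have add': "\<psi>' i (\<lambda>x. g x + h x) = \<psi>' i g + \<psi>' i h"
    if "i \<in> insert None (Some ` Y)" "window_function g" "window_function h" for i g h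
  proof (cases i)
    case None
    then show ?thesis using that by (simp add: \<psi>'_def int)
  next
    case (Some j)
    then show ?thesis using that by (simp add: \<psi>'_def add image_iff)
  qed
  obtain r where [measurable]: "r \<in> borel_measurable lebesgue" and r: "\<And>x. \<bar>r x\<bar> = 1"
    and small: "\<And>i. i \<in> insert None (Some ` Y) \<Longrightarrow> \<bar>\<psi>' i (\<lambda>x. f x * r x)\<bar> < \<delta>'"
  proof (rule oscillation[of "insert None (Some ` Y)" "1 + B" \<psi>' f \<delta>'])
    fix i g h assume i: "i \<in> insert None (Some ` Y)" and g: "window_function g" and h: "window_function h"
    show "\<psi>' i (\<lambda>x. g x + h x) = \<psi>' i g + \<psi>' i h" by (rule add'[OF i g h])
    have "\<psi>' i (\<lambda>x. g x - h x) = \<psi>' i (\<lambda>x. g x + -1 * h x)" by simp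
    also have "\<dots> = \<psi>' i g + -1 * \<psi>' i h"
      using add'[OF i g window_function_scale[OF h, of "-1"]] scale'[OF i h, of "-1"] by simp
    finally show "\<psi>' i (\<lambda>x. g x - h x) = \<psi>' i g - \<psi>' i h" by simp
  next
    fix i g assume i: "i \<in> insert None (Some ` Y)" and g: "window_function g"
    have nonneg: "0 \<le> (\<integral>x. \<bar>g x\<bar> \<partial>lebesgue)" by simp
    show "\<bar>\<psi>' i g\<bar> \<le> (1 + B) * (\<integral>x. \<bar>g x\<bar> \<partial>lebesgue)"
    proof (cases i)
      case None
      have "\<bar>\<psi>' i g\<bar> \<le> (\<integral>x. \<bar>g x\<bar> \<partial>lebesgue)"
        using None by (simp add: \<psi>'_def integral_abs_bound)
      then show ?thesis using mult_nonneg_nonneg[OF B nonneg] by (simp add: distrib_right)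
    next
      case (Some j)
      then have "\<bar>\<psi>' i g\<bar> \<le> B * (\<integral>x. \<bar>g x\<bar> \<partial>lebesgue)"
        using i bound[OF _ g, of j] by (auto simp: \<psi>'_def)
      then show ?thesis using nonneg unfolding distrib_right by linarith
    qed
  qed (use Y B fw \<delta>' in auto)
  define s where "s = (\<integral>x. f x * r x \<partial>lebesgue)"
  have s: "\<bar>s\<bar> < \<delta>'"
    using small[of None] by (simp add: s_def \<psi>'_def)
  have frw: "window_function (\<lambda>x. f x * r x)"
    using r by (intro window_function_mult[OF fw, where B = 1]) auto
  define e where "e x = 1/2 * (f x * r x) + (- s / 2) * f x" for x
  have ew: "window_function e"
    unfolding e_def by (intro window_function_add window_function_scale frw fw)
  have e_eq: "e x = f x * ((r x - s) / 2)" for x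
    by (simp add: e_def field_simps)
  define g where "g x = f x + e x" for x
  have gw: "window_function g"
    unfolding g_def by (intro window_function_add fw ew)
  have rs: "1/2 \<le> \<bar>r x - s\<bar>" "\<bar>r x - s\<bar> \<le> 2" for x
    using r[of x] s \<delta>'(2) by linarith+
  have g0: "0 \<le> g x" for x
  proof -
    have "g x = f x * ((2 + (r x - s)) / 2)"
      by (simp add: g_def e_eq add_divide_distrib distrib_left)
    moreover have "0 \<le> (2 + (r x - s)) / 2"
      using rs(2)[of x] by (intro divide_nonneg_pos) linarith+
    ultimately show ?thesis using f0[of x] by (metis mult_nonneg_nonneg)
  qed
  have "(\<integral>x. e x \<partial>lebesgue) = 1/2 * s + (- s / 2) * 1"
    unfolding e_def s_def f1[symmetric]
    by (subst Bochner_Integration.integral_add) (use int[OF frw] int[OF fw] in auto)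
  then have "(\<integral>x. g x \<partial>lebesgue) = 1"
    unfolding g_def using int[OF fw] int[OF ew] f1 by simp
  then have gD: "g \<in> densities" using gw g0 by (simp add: densities_def)
  show ?thesis
  proof (rule that[OF gD])
    fix i assume i: "i \<in> Y"
    have "\<psi> i g - \<psi> i f = 1/2 * \<psi> i (\<lambda>x. f x * r x) + (- s / 2) * \<psi> i f"
      unfolding g_def e_def using i frw fw
      by (simp only: add scale window_function_add window_function_scale)
    also have "\<bar>\<dots>\<bar> \<le> 1/2 * \<bar>\<psi> i (\<lambda>x. f x * r x)\<bar> + \<bar>s\<bar> / 2 * \<bar>\<psi> i f\<bar>"
      by (rule order_trans[OF abs_triangle_ineq]) (simp add: abs_mult)
    also have "\<bar>s\<bar> / 2 * \<bar>\<psi> i f\<bar> \<le> \<delta>' / 2 * B"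
      using bound[OF i fw] s f1 f0 B by (intro mult_mono) auto
    also have "1/2 * \<bar>\<psi> i (\<lambda>x. f x * r x)\<bar> < \<delta>' / 2"
      using small[of "Some i"] i by (simp add: \<psi>'_def)
    finally have "\<bar>\<psi> i g - \<psi> i f\<bar> < \<delta>' / 2 + \<delta>' / 2 * B" by simp
    also have "\<dots> = \<delta>' * (1 + B) / 2"
      by (simp add: field_simps)
    also have "\<dots> \<le> \<delta>"
      using \<delta>'(3) \<delta> by linarith
    finally show "\<bar>\<psi> i g - \<psi> i f\<bar> < \<delta>" .
  next
    have "1/4 = (\<integral>x. 1/4 * f x \<partial>lebesgue)"
      using f1 by simp
    also have "\<dots> \<le> (\<integral>x. \<bar>e x\<bar> \<partial>lebesgue)"
    proof (rule integral_mono)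
      fix x
      have "f x * (1/4) \<le> f x * (\<bar>r x - s\<bar> / 2)"
        using rs(1)[of x] by (intro mult_left_mono f0) simp
      then show "1/4 * f x \<le> \<bar>e x\<bar>"
        using f0[of x] by (simp add: e_eq abs_mult)
    qed (use int[OF fw] int[OF ew] in auto)
    finally show "1/4 \<le> (\<integral>x. \<bar>g x - f x\<bar> \<partial>lebesgue)"
      by (simp add: g_def)
  qed
qed

text \<open>Composed with the copy of L1, the isomorphism \<open>T\<close> gives a linear map
  \<open>E\<close> with estimates by the L1 norm from both sides. The upper one makes the image of
  the densities bounded, so it has a small slice; the lower one keeps a perturbed density at a
  distance that the slice does not allow.\<close>

theorem not_dual:
  "\<not> isomorphic_to_dual_of (Ces p I) (ces_norm p I) TYPE('y::banach)"
proof
  let ?V = "Ces p I" and ?N = "ces_norm p I"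
  assume "isomorphic_to_dual_of (Ces p I) (ces_norm p I) TYPE('y)"
  then obtain T :: "lfun \<Rightarrow> ('y \<Rightarrow>\<^sub>L real)" where T_add: "\<And>F G. F \<in> ?V \<Longrightarrow> G \<in> ?V \<Longrightarrow> T (F + G) = T F + T G"
    and T_scale: "\<And>c F. F \<in> ?V \<Longrightarrow> T (c *\<^sub>R F) = c *\<^sub>R T F"
    and T_bij: "bij_betw T ?V UNIV"
    and T_bdd: "\<exists>C. \<forall>F\<in>?V. norm (T F) \<le> C * ?N F" "\<exists>C. \<forall>F\<in>?V. ?N F \<le> C * norm (T F)"
    unfolding isomorphic_to_dual_of_def linear_homeomorphism_def by blast
  have pos: "\<exists>C'\<ge>0. \<forall>F\<in>?V. a F \<le> C' * b F" if ex: "\<exists>C. \<forall>F\<in>?V. a F \<le> C * b F" and nonneg: "\<And>F. 0 \<le> b F"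
    for a b :: "lfun \<Rightarrow> real"
  proof -
    obtain C where "\<forall>F\<in>?V. a F \<le> C * b F" using ex by blast
    moreover have "C * b F \<le> \<bar>C\<bar> * b F" for F
      using nonneg by (intro mult_right_mono) auto
    ultimately show ?thesis by (intro exI[of _ "\<bar>C\<bar>"]) (auto intro: order_trans)
  qed
  obtain C1 where C1: "0 \<le> C1" "\<And>F. F \<in> ?V \<Longrightarrow> norm (T F) \<le> C1 * ?N F"
    using pos[OF T_bdd(1) ces_norm_nonneg] by blast
  obtain C2 where C2: "0 \<le> C2" "\<And>F. F \<in> ?V \<Longrightarrow> ?N F \<le> C2 * norm (T F)"
    using pos[OF T_bdd(2) norm_ge_zero] by blast
  have T_diff: "T (F - G) = T F - T G" if "F \<in> ?V" "G \<in> ?V" for F G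
  proof -
    have "- G \<in> ?V" using subspace_neg[OF subspace_Ces that(2)] .
    moreover have "T (- G) = - T G" using T_scale[OF that(2), of "-1"] by simp
    ultimately show ?thesis using T_add[OF that(1), of "- G"] by simp
  qed
  define A where "A = C1 * enn2real (tail (1/4)) powr (1/p)"
  have A: "0 \<le> A" using C1 by (simp add: A_def)
  define E where "E f = T (abs_lfun f)" for f
  have E_bound: "norm (E f) \<le> A * (\<integral>x. \<bar>f x\<bar> \<partial>lebesgue)" if "window_function f" for f
    using C1(2)[OF window_function_Ces(1)[OF that]]
      mult_left_mono[OF window_function_Ces(2)[OF that] C1(1)]
    by (simp add: A_def E_def mult.assoc)
  have E_add: "E (\<lambda>x. f x + g x) = E f + E g" if "window_function f" "window_function g" for f g
    using that T_add[OF window_function_Ces(1) window_function_Ces(1)]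
    by (simp add: E_def abs_lfun_add[symmetric] window_function_measurable)
  have E_scale: "E (\<lambda>x. c * f x) = c *\<^sub>R E f" if "window_function f" for c f
    using that T_scale[OF window_function_Ces(1)]
    by (simp add: E_def abs_lfun_scaleR[symmetric] window_function_measurable)
  have E_lower: "(\<integral>x. \<bar>g x - f x\<bar> \<partial>lebesgue) \<le> 2 * C2 * norm (E g - E f)"
    if f: "window_function f" and g: "window_function g" for f g
  proof -
    have gf: "window_function (\<lambda>x. g x - f x)" by (rule window_function_diff[OF g f])
    note [measurable] = window_function_measurable[OF f] window_function_measurable[OF g]
    have eq: "abs_lfun (\<lambda>x. g x - f x) = abs_lfun g - abs_lfun f"
      by (simp add: abs_lfun_diff)
    have "ennreal (\<integral>x. \<bar>g x - f x\<bar> \<partial>lebesgue) = (\<integral>\<^sup>+x. ennreal \<bar>g x - f x\<bar> \<partial>lebesgue)"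
      using window_function_integrable[OF gf] by (intro nn_integral_eq_integral[symmetric]) auto
    also have "\<dots> = mass W (abs_lfun (\<lambda>x. g x - f x))"
      using window_function_off[OF gf]
      by (subst mass_abs, measurable, intro nn_integral_cong) (auto split: split_indicator)
    also have "\<dots> \<le> ennreal (2 * ?N (abs_lfun (\<lambda>x. g x - f x)))"
      by (rule mass_W_le[OF window_function_Ces(1)[OF gf]])
    finally have "(\<integral>x. \<bar>g x - f x\<bar> \<partial>lebesgue) \<le> 2 * ?N (abs_lfun (\<lambda>x. g x - f x))"
      by (simp add: ces_norm_nonneg)
    also have "?N (abs_lfun (\<lambda>x. g x - f x)) \<le> C2 * norm (T (abs_lfun (\<lambda>x. g x - f x)))"
      by (rule C2(2)[OF window_function_Ces(1)[OF gf]])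
    also have "T (abs_lfun (\<lambda>x. g x - f x)) = E g - E f"
      unfolding eq E_def using f g by (intro T_diff window_function_Ces)
    finally show ?thesis by simp
  qed
  have E_norm: "norm (E f) \<le> A" if "f \<in> densities" for f
    using that E_bound[of f] by (auto simp: densities_def)
  obtain D where D: "countable D" "D \<subseteq> ?V" "\<And>F e. F \<in> ?V \<Longrightarrow> 0 < e \<Longrightarrow> \<exists>d\<in>D. ?N (F - d) < e"
    using separable by blast
  have dense: "\<exists>d\<in>T ` D. norm (\<xi> - d) < e" if e: "0 < e" for \<xi> e
  proof -
    obtain F where F: "F \<in> ?V" "\<xi> = T F" using T_bij by (auto simp: bij_betw_def)
    obtain d where d: "d \<in> D" "?N (F - d) < e / (C1 + 1)"
      using D(3)[OF F(1), of "e / (C1 + 1)"] e C1(1) by auto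
    then have "d \<in> ?V" using D(2) by blast
    then have "norm (\<xi> - T d) \<le> C1 * ?N (F - d)"
      using C1(2)[OF subspace_diff[OF subspace_Ces F(1)]] F by (simp add: T_diff)
    also have "\<dots> \<le> (C1 + 1) * ?N (F - d)"
      by (intro mult_right_mono ces_norm_nonneg) simp
    also have "\<dots> < e" using d(2) C1(1) by (simp add: pos_less_divide_eq mult.commute)
    finally show ?thesis using d(1) by blast
  qed
  \<comment> \<open>A perturbation of L1 size at least 1/4 needs
    \<open>1/4 \<le> 2 * C2 * \<epsilon>\<close>, but the right-hand side is
    \<open>C2 / (8 * (C2 + 1))\<close>. The summand 1 covers \<open>C2 = 0\<close>.\<close>
  define \<epsilon> where "\<epsilon> = 1 / (16 * (C2 + 1))"
  have \<epsilon>: "0 < \<epsilon>" using C2(1) by (simp add: \<epsilon>_def)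
  have bdd: "bounded (E ` densities)"
    unfolding bounded_iff using E_norm by blast
  have ne: "E ` densities \<noteq> {}" and count: "countable (T ` D)"
    using densities_nonempty D(1) by auto
  obtain \<xi>0 Y \<delta> where \<xi>0: "\<xi>0 \<in> E ` densities" and Y: "finite Y" "0 < \<delta>"
    and slice: "\<And>\<xi>. \<xi> \<in> E ` densities \<Longrightarrow>
      \<forall>y\<in>Y. \<bar>blinfun_apply \<xi> y - blinfun_apply \<xi>0 y\<bar> < \<delta> \<Longrightarrow> norm (\<xi> - \<xi>0) \<le> \<epsilon>"
  proof (rule separable_dual_small_slice[OF bdd ne count dense \<epsilon>])
    fix \<xi>0 Y and \<delta> :: real
    assume "\<xi>0 \<in> E ` densities" "finite Y" "0 < \<delta>"
      "\<And>\<xi>. \<xi> \<in> E ` densities \<Longrightarrow>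
        \<forall>y\<in>Y. \<bar>blinfun_apply \<xi> y - blinfun_apply \<xi>0 y\<bar> < \<delta> \<Longrightarrow> norm (\<xi> - \<xi>0) \<le> \<epsilon>"
    then show thesis by (rule that)
  qed
  then obtain f where f: "f \<in> densities" "\<xi>0 = E f" by blast
  \<comment> \<open>One constant for all evaluations at points of \<open>Y\<close>: each norm is at
    most the sum of the norms.\<close>
  define B where "B = A * (\<Sum>y\<in>Y. norm y)"
  have B: "0 \<le> B" using A by (simp add: B_def sum_nonneg)
  obtain g where g: "g \<in> densities"
    and near: "\<And>y. y \<in> Y \<Longrightarrow> \<bar>blinfun_apply (E g) y - blinfun_apply (E f) y\<bar> < \<delta>"
    and far: "1/4 \<le> (\<integral>x. \<bar>g x - f x\<bar> \<partial>lebesgue)"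
  proof (rule density_perturbation[of Y B "\<lambda>y f. blinfun_apply (E f) y" f \<delta>])
    fix y f assume y: "y \<in> Y" and f: "window_function f"
    have "\<bar>blinfun_apply (E f) y\<bar> \<le> norm (E f) * norm y"
      using norm_blinfun[of "E f" y] by simp
    also have "\<dots> \<le> (A * (\<integral>x. \<bar>f x\<bar> \<partial>lebesgue)) * (\<Sum>y\<in>Y. norm y)"
      using E_bound[OF f] y Y(1) A by (intro mult_mono member_le_sum) auto
    finally show "\<bar>blinfun_apply (E f) y\<bar> \<le> B * (\<integral>x. \<bar>f x\<bar> \<partial>lebesgue)"
      by (simp add: B_def ac_simps)
  qed (use Y B f E_add E_scale in \<open>auto simp: blinfun.add_left blinfun.scaleR_left\<close>)
  have "norm (E g - E f) \<le> \<epsilon>"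
    using slice[of "E g"] g near f(2) by auto
  moreover have "1/4 \<le> 2 * C2 * norm (E g - E f)"
    using far E_lower[of f g] f g by (auto simp: densities_def)
  ultimately have "1/4 \<le> 2 * C2 * \<epsilon>"
    using mult_left_mono[of "norm (E g - E f)" \<epsilon> "2 * C2"] C2(1) by linarith
  also have "\<dots> < 1/4" using C2(1) by (simp add: \<epsilon>_def field_simps)
  finally show False by simp
qed

end

theorem theorem3:
  fixes p :: real and I :: "real set"
  assumes "1 \<le> p"
    and "I = {0..1} \<or> I = {0..}"
    and "\<not> (p = 1 \<and> I = {0..})"
  shows "\<not> isomorphic_to_dual_of (Ces p I) (ces_norm p I) TYPE('y::banach) \<and>
         \<not> radon_nikodym_property TYPE(real) (Ces p I) (ces_norm p I)"
proof -
  interpret cesaro_space p I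
    using assms by unfold_locales
  show ?thesis
    using not_dual not_radon_nikodym by blast
qed

end
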